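(* Let $n\ge 1$. The set of normalized block characters of $\mathfrak{S}_n$ is a simplex whose extreme points are the normalized characters $\tau_k^n(\cdot)/\tau_k^n(e)$, $k=1,\dots,n$.
   Context: $\mathfrak{S}_n$ is the group of permutations of $\{1,\dots,n\}$, $e$ its identity, and $\ell_n(g)$ is the number of cycles of $g\in\mathfrak{S}_n$ (fixed points count as cycles). A character of a group $G$ is a function $\chi:G\to\mathbb{C}$ that is central ($\chi(a^{-1}ba)=\chi(b)$) and positive definite (for every finite collection $(g_i)$ in $G$ the matrix $(\chi(g_ig_j^{-1}))_{i,j}$ is Hermitian and non-negative definite). It is normalized if $\chi(e)=1$. A block function on $\mathfrak{S}_n$ is a complex-valued function depending on $g$ only through $\ell_n(g)$; a block character is a positive definite block function. For an integer $k\ge1$ put $\sigma_k^n(g)=k^{\ell_n(g)}$, and for $k=1,\dots,n$ define $$\tau_k^n=\sum_{j=0}^{k-1}(-1)^j\binom{n+1}{j}\sigma^n_{k-j}.$$ *)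

theory Defs
  imports
    "HOL-Analysis.Polytope"
    "HOL-Library.Function_Algebras"
    "HOL-Library.Nonpos_Ints"
    "HOL-Combinatorics.Orbits"
    "HOL-Algebra.Sym_Groups"
begin

text \<open>
  The pointwise real vector space structure on functions, needed for convexity notions
  (\<^const>\<open>convex\<close>, \<^const>\<open>affine_dependent\<close>, \<^const>\<open>extreme_point_of\<close>) on sets of functions.
\<close>

instantiation "fun" :: (type, real_vector) real_vector
begin

definition scaleR_fun :: "real \<Rightarrow> ('a \<Rightarrow> 'b) \<Rightarrow> 'a \<Rightarrow> 'b" where
  "scaleR_fun r f = (\<lambda>x. r *\<^sub>R f x)"

instance
  by standard (simp_all add: scaleR_fun_def fun_eq_iff scaleR_add_right scaleR_add_left)

end

text \<open>
  The library's \<^const>\<open>simplex\<close>, with its dimension left implicit, in an arbitrary real vector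
  space rather than a Euclidean space.
\<close>

definition is_simplex :: "'a::real_vector set \<Rightarrow> bool" where
  "is_simplex S \<longleftrightarrow> (\<exists>C. finite C \<and> \<not> affine_dependent C \<and> S = convex hull C)"

text \<open>Only the entries with indices below \<open>m\<close> of the array \<open>M\<close> are meaningful.\<close>

definition hermitian :: "nat \<Rightarrow> (nat \<Rightarrow> nat \<Rightarrow> complex) \<Rightarrow> bool" where
  "hermitian m M \<longleftrightarrow> (\<forall>i<m. \<forall>j<m. M i j = cnj (M j i))"

definition nonneg_definite :: "nat \<Rightarrow> (nat \<Rightarrow> nat \<Rightarrow> complex) \<Rightarrow> bool" where
  "nonneg_definite m M \<longleftrightarrow>
     (\<forall>x :: nat \<Rightarrow> complex. (\<Sum>i<m. \<Sum>j<m. cnj (x i) * M i j * x j) \<in> \<real>\<^sub>\<ge>\<^sub>0)"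

definition positive_definite_fun :: "('a, 'b) monoid_scheme \<Rightarrow> ('a \<Rightarrow> complex) \<Rightarrow> bool" where
  "positive_definite_fun G \<phi> \<longleftrightarrow>
     (\<forall>m. \<forall>g :: nat \<Rightarrow> 'a. (\<forall>i<m. g i \<in> carrier G) \<longrightarrow>
        hermitian m (\<lambda>i j. \<phi> (g i \<otimes>\<^bsub>G\<^esub> inv\<^bsub>G\<^esub> (g j))) \<and>
        nonneg_definite m (\<lambda>i j. \<phi> (g i \<otimes>\<^bsub>G\<^esub> inv\<^bsub>G\<^esub> (g j))))"

text \<open>
  The cycles of a permutation are its orbits; \<^const>\<open>orbit\<close> contains its base point because \<open>g\<close>
  has finite order, so a fixed point gives a singleton orbit.
\<close>

definition num_cycles :: "nat \<Rightarrow> (nat \<Rightarrow> nat) \<Rightarrow> nat" where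
  "num_cycles n g = card (orbit g ` {1..n})"

definition block_function :: "nat \<Rightarrow> ((nat \<Rightarrow> nat) \<Rightarrow> complex) \<Rightarrow> bool" where
  "block_function n \<phi> \<longleftrightarrow> (\<exists>f. \<forall>g \<in> carrier (sym_group n). \<phi> g = f (num_cycles n g))"

definition block_character :: "nat \<Rightarrow> ((nat \<Rightarrow> nat) \<Rightarrow> complex) \<Rightarrow> bool" where
  "block_character n \<phi> \<longleftrightarrow> block_function n \<phi> \<and> positive_definite_fun (sym_group n) \<phi>"

text \<open>
  A function on the symmetric group is represented by its extension by zero to all of
  \<^typ>\<open>nat \<Rightarrow> nat\<close>. This makes the representation unique and compatible with the vector space
  operations.
\<close>

definition normalized_block_characters :: "nat \<Rightarrow> ((nat \<Rightarrow> nat) \<Rightarrow> complex) set" where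
  "normalized_block_characters n =
     {\<phi>. block_character n \<phi> \<and> \<phi> \<one>\<^bsub>sym_group n\<^esub> = 1 \<and>
          (\<forall>g. g \<notin> carrier (sym_group n) \<longrightarrow> \<phi> g = 0)}"

definition block_sigma :: "nat \<Rightarrow> nat \<Rightarrow> (nat \<Rightarrow> nat) \<Rightarrow> complex" where
  "block_sigma n k g = (if g \<in> carrier (sym_group n) then of_nat k ^ num_cycles n g else 0)"

definition block_tau :: "nat \<Rightarrow> nat \<Rightarrow> (nat \<Rightarrow> nat) \<Rightarrow> complex" where
  "block_tau n k g = (\<Sum>j<k. (-1) ^ j * of_nat ((n + 1) choose j) * block_sigma n (k - j) g)"

end

theory Submission
  imports Defs "HOL-Analysis.Function_Topology"
begin

text \<open>
  The operator of convolution with \<open>g \<mapsto> t ^ \<ell>(g)\<close> on functions on the symmetric group is the product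
  of the operators \<open>t + J\<^sub>i\<close> over the Jucys-Murphy elements \<open>J\<^sub>i = \<Sum>\<^bsub>l<i\<^esub> (l i)\<close>. On a joint eigenvector of
  the \<open>J\<^sub>i\<close> with eigenvalues \<open>a\<^sub>1, \<dots>, a\<^sub>n\<close>, convolution with \<open>\<tau>\<^sub>k\<close> is therefore the scalar
  \<open>\<Sum>\<^bsub>j<k\<^esub> (-1)\<^sup>j (n+1 choose j) \<Prod>\<^sub>i (k - j + a\<^sub>i)\<close>. Appending one factor \<open>x + a\<close> to the product changes this
  expression by an Eulerian-type recurrence, whose coefficients are nonnegative for the joint spectrum
  (integers starting from 0, each exceeding some earlier one by at most 1 and falling below some
  earlier one by at most 1). Hence \<open>\<tau>\<^sub>k\<close> is positive definite.

  Conversely, a positive definite class function is nonnegative at Young symmetrizers. On block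
  functions the hook with arm \<open>n + 1 - k\<close> gives, by the same recurrence, a functional that takes the
  value \<open>n!\<close> at \<open>\<tau>\<^sub>k\<close> and 0 at every other \<open>\<tau>\<^sub>j\<close>. Since the \<open>\<tau>\<^sub>j\<close> span the block functions, the coordinates
  of a block character are nonnegative.
\<close>

subsection \<open>Alternating binomial sums\<close>

text \<open>The coefficient of z^k in (1 - z)^(m + 1) times the sum of p(x) z^x over x \<ge> 1. For
  \<open>p x = x ^ m\<close> these are the Eulerian numbers; for \<open>m = n\<close> and
  \<open>p x = x ^ l\<close> they are the values of tau_k at permutations with \<open>l\<close>
  cycles.\<close>

definition eulerian :: "nat \<Rightarrow> (nat \<Rightarrow> 'a::comm_ring_1) \<Rightarrow> nat \<Rightarrow> 'a" where
  "eulerian m p k = (\<Sum>j<k. (-1) ^ j * of_nat ((m + 1) choose j) * p (k - j))"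

lemma eulerian_0 [simp]: "eulerian m p 0 = 0"
  by (simp add: eulerian_def)

lemma eulerian_constant:
  "eulerian 0 (\<lambda>x. 1) k = (if k = 1 then 1 else (0::'a::comm_ring_1))"
proof -
  have *: "(\<Sum>j<k. (-1) ^ j * of_nat (Suc 0 choose j)) = (if k = 1 then 1 else (0::'a))"
  proof (induction k)
    case (Suc k)
    then show ?case by (cases k; cases "k - 1") (auto simp: binomial_eq_0)
  qed simp
  then show ?thesis by (simp add: eulerian_def)
qed

text \<open>Absorption trades the factor \<open>Suc j\<close> for \<open>m + 2\<close>, and Pascal's
  rule splits what remains. This is the comparison of the coefficients of \<open>p (k - j)\<close>
  in \<open>eulerian_mult_linear\<close>.\<close>

lemma eulerian_coefficient:
  fixes a :: "'a::comm_ring_1"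
  shows "of_nat (m + 2 choose Suc j) * (of_nat (k + 1) + a - of_nat (Suc j)) =
    (of_nat (k + 1) + a) * of_nat (m + 1 choose Suc j) -
    (of_nat (m + 1) - of_nat k - a) * of_nat (m + 1 choose j)"
proof -
  have "(m + 2) * (m + 1 choose j) = Suc j * (m + 2 choose Suc j)"
    using Suc_times_binomial_eq[of "m + 1" j] by (simp add: mult.commute)
  then have absorb: "(of_nat m + 2) * of_nat (m + 1 choose j) = (of_nat j + 1) * (of_nat (m + 2 choose Suc j) :: 'a)"
    by (metis of_nat_Suc of_nat_add of_nat_mult of_nat_numeral add.commute)
  have pascal: "of_nat (m + 2 choose Suc j) = of_nat (m + 1 choose Suc j) + (of_nat (m + 1 choose j) :: 'a)"
    by simp
  have "of_nat (m + 2 choose Suc j) * (of_nat (k + 1) + a - of_nat (Suc j)) =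
     (of_nat k + 1 + a) * of_nat (m + 2 choose Suc j) - (of_nat m + 2) * of_nat (m + 1 choose j)"
    using absorb by (simp add: algebra_simps del: binomial_Suc_Suc)
  then show ?thesis unfolding pascal by (simp add: algebra_simps del: binomial_Suc_Suc)
qed

text \<open>The classical Eulerian recurrence is the case \<open>a = 0\<close>,
  \<open>p x = x ^ m\<close>. A linear factor of \<open>p\<close> raises the binomial row by one, so
  a product of linear factors can be treated factor by factor.\<close>

lemma eulerian_mult_linear:
  fixes a :: "'a::comm_ring_1"
  shows "eulerian (Suc m) (\<lambda>x. (of_nat x + a) * p x) (Suc k) =
    (of_nat (k + 1) + a) * eulerian m p (Suc k) + (of_nat (m + 1) - of_nat k - a) * eulerian m p k"
proof -
  let ?s = "\<lambda>j. (-1) ^ j * p (Suc k - j)"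
  \<comment> \<open>With the term \<open>j = 0\<close> split off, the sums for \<open>Suc k\<close>
    run over the same points \<open>k - j\<close> as the sum for \<open>k\<close>.\<close>
  have e: "eulerian M q (Suc k) = q (Suc k) - (\<Sum>j<k. (-1) ^ j * of_nat (M + 1 choose Suc j) * q (k - j))"
    for M and q :: "nat \<Rightarrow> 'a"
    by (simp add: eulerian_def sum.lessThan_Suc_shift sum_negf del: sum.lessThan_Suc binomial_Suc_Suc)
  have "(-1) ^ j * of_nat (Suc m + 1 choose Suc j) * ((of_nat (k - j) + a) * p (k - j)) =
     (of_nat (k + 1) + a) * ((-1) ^ j * of_nat (m + 1 choose Suc j) * p (k - j)) -
     (of_nat (m + 1) - of_nat k - a) * ((-1) ^ j * of_nat (m + 1 choose j) * p (k - j))"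
    if "j < k" for j
  proof -
    have "of_nat (k - j) + a = of_nat (k + 1) + a - of_nat (Suc j)"
      using that by (simp add: of_nat_diff)
    then have "of_nat (Suc m + 1 choose Suc j) * (of_nat (k - j) + a) =
      (of_nat (k + 1) + a) * of_nat (m + 1 choose Suc j) -
      (of_nat (m + 1) - of_nat k - a) * of_nat (m + 1 choose j)"
      using eulerian_coefficient[of m j k a] by (simp only: add_2_eq_Suc' Suc_eq_plus1[symmetric] add_Suc)
    then have "(-1) ^ j * (of_nat (Suc m + 1 choose Suc j) * (of_nat (k - j) + a)) * p (k - j) =
      (-1) ^ j * ((of_nat (k + 1) + a) * of_nat (m + 1 choose Suc j) -
      (of_nat (m + 1) - of_nat k - a) * of_nat (m + 1 choose j)) * p (k - j)" by simp
    then show ?thesis by (simp only: algebra_simps)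
  qed
  then have "(\<Sum>j<k. (-1) ^ j * of_nat (Suc m + 1 choose Suc j) * ((of_nat (k - j) + a) * p (k - j))) =
     (of_nat (k + 1) + a) * (\<Sum>j<k. (-1) ^ j * of_nat (m + 1 choose Suc j) * p (k - j)) -
     (of_nat (m + 1) - of_nat k - a) * eulerian m p k"
    by (simp add: eulerian_def sum_distrib_left sum_subtractf[symmetric] del: binomial_Suc_Suc)
  then show ?thesis
    unfolding e[of "Suc m"] e[of m p] by (simp add: algebra_simps del: binomial_Suc_Suc)
qed

lemma eulerian_power_pos:
  assumes "k \<in> {1..m}"
  shows "eulerian m (\<lambda>x. of_nat x ^ m) k > (0 :: 'a :: linordered_idom)"
proof -
  have step: "eulerian (Suc m) (\<lambda>x. of_nat x ^ Suc m) (Suc k) =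
    of_nat (k + 1) * eulerian m (\<lambda>x. of_nat x ^ m) (Suc k) + (of_nat (m + 1) - of_nat k) * (eulerian m (\<lambda>x. of_nat x ^ m) k :: 'a)"
    for m k
    using eulerian_mult_linear[of m 0 "\<lambda>x. of_nat x ^ m" k] by simp
  \<comment> \<open>The second coefficient of the recurrence turns negative for large
    \<open>k\<close>, so vanishing above the range is carried along. The exponent starts at 1: for
    exponent 0 the range is empty but the value at \<open>k = 1\<close> is 1.\<close>
  have "eulerian (Suc m) (\<lambda>x. of_nat x ^ Suc m) k \<ge> (0::'a) \<and>
      (k \<in> {1..Suc m} \<longrightarrow> eulerian (Suc m) (\<lambda>x. of_nat x ^ Suc m) k > (0::'a)) \<and>
      (k > Suc m \<longrightarrow> eulerian (Suc m) (\<lambda>x. of_nat x ^ Suc m) k = (0::'a))" for m k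
  proof (induction m arbitrary: k)
    case 0
    show ?case
    proof (cases k)
      case (Suc k')
      then show ?thesis using step[of 0 k'] eulerian_constant[where 'a='a]
        by auto
    qed simp
  next
    case (Suc m)
    show ?case
    proof (cases k)
      case (Suc k')
      let ?u = "eulerian (Suc m) (\<lambda>x. of_nat x ^ Suc m) (Suc k') :: 'a"
      let ?v = "eulerian (Suc m) (\<lambda>x. of_nat x ^ Suc m) k' :: 'a"
      have v0: "?v \<ge> 0" "?u \<ge> 0" using Suc.IH by blast+
      consider "k' = 0" | "k' \<in> {1..Suc m}" | "k' > Suc m" by force
      then show ?thesis
      proof cases
        case 1
        then have "?u > 0" using Suc.IH[of "Suc k'"] by auto
        with 1 show ?thesis unfolding Suc step by simp
      next
        case 2
        then have "?v > 0" using Suc.IH[of "k'"] by blast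
        moreover have "of_nat (Suc m + 1) - of_nat k' > (0::'a)"
          using 2 by (metis add.commute atLeastAtMost_iff le_imp_less_Suc of_nat_less_iff plus_1_eq_Suc diff_gt_0_iff_gt)
        ultimately have "(of_nat (Suc m + 1) - of_nat k') * ?v > 0" by simp
        moreover have "of_nat (k' + 1) * ?u \<ge> 0" using v0 by simp
        ultimately show ?thesis using 2 unfolding Suc step by auto
      next
        case 3
        then have "?u = 0" "?v = 0" using Suc.IH[of "k'"] Suc.IH[of "Suc k'"] by auto
        then show ?thesis using 3 unfolding Suc step by auto
      qed
    qed simp
  qed
  from this[of "m - 1" k] assms show ?thesis by (cases m) auto
qed

subsection \<open>Numbers of cycles\<close>

lemma num_cycles_id [simp]: "num_cycles n id = n"
proof -
  have "orbit id x = {x}" for x :: nat by (simp add: orbit_eq_singleton_iff)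
  then have "inj_on (orbit id) {1..n}" by (auto simp: inj_on_def)
  then show ?thesis by (simp add: num_cycles_def card_image)
qed

lemma card_image_eq_if_same_kernel:
  assumes "\<And>x y. x \<in> A \<Longrightarrow> y \<in> A \<Longrightarrow> f x = f y \<longleftrightarrow> g x = g y"
  shows "card (f ` A) = card (g ` A)"
proof -
  have "bij_betw (\<lambda>z. g (inv_into A f z)) (f ` A) (g ` A)"
  proof (rule bij_betw_imageI)
    show "inj_on (\<lambda>z. g (inv_into A f z)) (f ` A)"
      by (intro inj_onI) (metis assms f_inv_into_f inv_into_into)
    show "(\<lambda>z. g (inv_into A f z)) ` f ` A = g ` A"
      using assms by (auto simp: image_iff) (metis f_inv_into_f imageI inv_into_into)+
  qed
  then show ?thesis by (rule bij_betw_same_card)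
qed

lemma num_cycles_inv:
  assumes "g permutes {1..n}"
  shows "num_cycles n (inv' g) = num_cycles n g"
proof -
  have "permutation g" using assms by (auto simp: permutation_permutes)
  then show ?thesis by (simp add: num_cycles_def orbit_inv_eq)
qed

lemma num_cycles_conj:
  assumes a: "a permutes {1..n}" and b: "b permutes {1..n}"
  shows "num_cycles n (a \<circ> b \<circ> inv' a) = num_cycles n b"
proof -
  have pb: "permutation b" using b by (auto simp: permutation_permutes)
  have "orbit (a \<circ> b \<circ> inv' a) (a x) = a ` orbit b x" for x
    using orbit_inverse[of x b "a \<circ> b \<circ> inv' a" a] permutation_self_in_orbit[OF pb]
    by (simp add: permutes_inverses[OF a])
  then have "orbit (a \<circ> b \<circ> inv' a) ` {1..n} = (`) a ` orbit b ` {1..n}"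
    using permutes_image[OF a] by (metis (no_types, lifting) image_cong image_image)
  then show ?thesis
    using permutes_inj[OF a] by (simp add: num_cycles_def card_image inj_on_def inj_image_eq_iff)
qed

lemma num_cycles_comp_commute:
  assumes a: "a permutes {1..n}" and b: "b permutes {1..n}"
  shows "num_cycles n (a \<circ> b) = num_cycles n (b \<circ> a)"
proof -
  have "b \<circ> (a \<circ> b) \<circ> inv' b = b \<circ> a"
    by (metis b comp_assoc comp_id permutes_inv_o(1))
  then show ?thesis using num_cycles_conj[OF b permutes_compose[OF b a]] by simp
qed

lemma num_cycles_Suc:
  assumes q: "q permutes {1..m}"
  shows "num_cycles (Suc m) q = Suc (num_cycles m q)"
proof -
  have "q (Suc m) = Suc m" using q by (simp add: permutes_def)
  then have "orbit q (Suc m) = {Suc m}" by (simp add: orbit_eq_singleton_iff)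
  moreover have "Suc m \<notin> orbit q x" if "x \<in> {1..m}" for x
    using permutes_orbit_subset[OF q that] by auto
  ultimately have "orbit q (Suc m) \<notin> orbit q ` {1..m}" by (metis imageE singletonI)
  moreover have "{1..Suc m} = insert (Suc m) {1..m}" by auto
  ultimately show ?thesis by (simp add: num_cycles_def)
qed

text \<open>The transposition inserts \<open>Suc m\<close> into the cycle of \<open>b\<close>, just
  before \<open>b\<close>, and leaves the other cycles alone, so the partition of
  \<open>{1..m}\<close> into cycles is unchanged.\<close>

lemma num_cycles_transpose_comp:
  assumes q: "q permutes {1..m}" and b: "b \<in> {1..m}"
  shows "num_cycles (Suc m) (Transposition.transpose (Suc m) b \<circ> q) = num_cycles m q"
proof -
  define g where "g = Transposition.transpose (Suc m) b \<circ> q"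
  have "q permutes {1..Suc m}" using q by (rule permutes_subset) auto
  moreover have "Transposition.transpose (Suc m) b permutes {1..Suc m}" using b by (intro permutes_swap_id) auto
  ultimately have g: "g permutes {1..Suc m}" unfolding g_def by (rule permutes_compose)
  then have pg: "permutation g" by (auto simp: permutation_permutes)
  have pq: "permutation q" using q by (auto simp: permutation_permutes)
  have qm: "q (Suc m) = Suc m" using q by (simp add: permutes_def)
  then have gm: "g (Suc m) = b" by (simp add: g_def)
  have g1: "g y = (if q y = b then Suc m else q y)" if "y \<in> {1..m}" for y
    using that b permutes_in_image[OF q, of y] by (auto simp: g_def Transposition.transpose_def)
  have sub: "orbit q x \<subseteq> {1..m}" if "x \<in> {1..m}" for x
    using permutes_orbit_subset[OF q that] .
  have 1: "y \<in> orbit g x" if "y \<in> orbit q x" "x \<in> {1..m}" for x y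
    using that(1)
  proof induction
    case base
    then show ?case using g1[OF that(2)] gm by (metis orbit.base orbit.step)
  next
    case (step y)
    then have "y \<in> {1..m}" using sub that(2) by blast
    then show ?case using g1[of y] gm step by (metis orbit.step)
  qed
  \<comment> \<open>An orbit of \<open>g\<close> may pass through \<open>Suc m\<close>; there the
    next point \<open>b\<close> stands in for it.\<close>
  have 2: "if y = Suc m then b \<in> orbit q x else y \<in> orbit q x" if "y \<in> orbit g x" "x \<in> {1..m}" for x y
    using that(1)
  proof induction
    case base
    show ?case using g1[OF that(2)] orbit.base[of q x] sub[OF that(2)] by auto
  next
    case (step y)
    show ?case
    proof (cases "y = Suc m")
      case True
      then show ?thesis using step gm b by auto
    next
      case False
      then have y: "y \<in> orbit q x" using step by auto
      then have "y \<in> {1..m}" using sub that(2) by blast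
      then show ?thesis using g1[of y] orbit.step[OF y] sub[OF that(2)] by auto
    qed
  qed
  have 3: "orbit q x = orbit g x \<inter> {1..m}" if "x \<in> {1..m}" for x
    using 1 2 sub that by (fastforce split: if_splits)
  have "orbit g x = orbit g y \<longleftrightarrow> orbit q x = orbit q y" if "x \<in> {1..m}" "y \<in> {1..m}" for x y
  proof
    show "orbit g x = orbit g y \<Longrightarrow> orbit q x = orbit q y" using 3 that by simp
    assume "orbit q x = orbit q y"
    then have "x \<in> orbit q y" using permutation_self_in_orbit[OF pq] by blast
    then have "x \<in> orbit g y" using 1 that by blast
    then show "orbit g x = orbit g y"
      by (meson cyclic_on_orbit' orbit_cyclic_eq3 pg)
  qed
  then have "card (orbit g ` {1..m}) = card (orbit q ` {1..m})"
    by (rule card_image_eq_if_same_kernel)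
  moreover have "orbit g ` {1..Suc m} = orbit g ` {1..m}"
  proof -
    have "orbit g (Suc m) = orbit g b" using permutation_orbit_step[OF pg, of "Suc m"] gm by simp
    moreover have "{1..Suc m} = insert (Suc m) {1..m}" by auto
    ultimately show ?thesis using b by auto
  qed
  ultimately show ?thesis by (simp add: num_cycles_def g_def)
qed

subsection \<open>Symmetric operators on functions with finite support\<close>

text \<open>Tychonoff's theorem. With the intervals shrunk to a point off a finite set, such a box
  contains the unit sphere of the functions supported on that set.\<close>

lemma compact_function_box:
  fixes l u :: "'a \<Rightarrow> real"
  shows "compact (PiE UNIV (\<lambda>x. {l x..u x}))"
proof -
  have "compactin (product_topology (\<lambda>_. euclidean) UNIV) (PiE UNIV (\<lambda>x. {l x..u x}))"
    unfolding compactin_PiE by auto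
  then show ?thesis by (simp add: euclidean_product_topology)
qed

lemma quadratic_nonneg_imp_linear_coeff_zero:
  fixes N Q :: real
  assumes "\<And>t. 0 \<le> 2 * t * N + t\<^sup>2 * Q"
  shows "N = 0"
proof (rule ccontr)
  assume "N \<noteq> 0"
  \<comment> \<open>The quadratic polynomial is tested at \<open>- N / r\<close>, its vertex with
    \<open>Q\<close> replaced by a larger positive number; this avoids cases on the sign of
    \<open>Q\<close>.\<close>
  define r where "r = \<bar>Q\<bar> + 1"
  have r: "r > 0" "Q < r" by (auto simp: r_def)
  have "0 \<le> 2 * (- N / r) * N + (- N / r)\<^sup>2 * Q" by (rule assms)
  also have "\<dots> = N\<^sup>2 / r\<^sup>2 * (Q - 2 * r)"
    using r by (simp add: field_simps power2_eq_square)
  also have "\<dots> < 0" using r \<open>N \<noteq> 0\<close> by (intro mult_pos_neg) auto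
  finally show False by simp
qed

text \<open>The Rayleigh quotient attains its minimum, and a minimizer is an eigenvector.\<close>

lemma symmetric_operator_eigenvector:
  fixes L :: "('a \<Rightarrow> real) \<Rightarrow> ('a \<Rightarrow> real)" and V :: "('a \<Rightarrow> real) set"
  assumes fin: "finite A"
    and closed: "closed V"
    and supp: "\<And>f x. f \<in> V \<Longrightarrow> x \<notin> A \<Longrightarrow> f x = 0"
    and sub: "\<And>f h c d. f \<in> V \<Longrightarrow> h \<in> V \<Longrightarrow> (\<lambda>x. c * f x + d * h x) \<in> V"
    and lin: "\<And>f h c d. L (\<lambda>x. c * f x + d * h x) = (\<lambda>x. c * L f x + d * L h x)"
    and cont: "\<And>x. continuous_on UNIV (\<lambda>f. L f x)"
    and inv: "\<And>f. f \<in> V \<Longrightarrow> L f \<in> V"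
    and sym: "\<And>f h. f \<in> V \<Longrightarrow> h \<in> V \<Longrightarrow> (\<Sum>x\<in>A. L f x * h x) = (\<Sum>x\<in>A. f x * L h x)"
    and f0: "f0 \<in> V" "(\<Sum>x\<in>A. f0 x * f0 x) \<noteq> 0"
  obtains v c where "v \<in> V" "(\<Sum>x\<in>A. v x * v x) \<noteq> 0" "L v = (\<lambda>x. c * v x)"
    "c * (\<Sum>x\<in>A. f0 x * f0 x) \<le> (\<Sum>x\<in>A. f0 x * L f0 x)"
proof -
  define ip where "ip f h = (\<Sum>x\<in>A. f x * h x)" for f h :: "'a \<Rightarrow> real"
  have ip_lin: "ip (\<lambda>x. c * f x + d * h x) k = c * ip f k + d * ip h k" for c d f h k
    by (simp add: ip_def sum.distrib sum_distrib_left algebra_simps)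
  have ip_com: "ip f h = ip h f" for f h by (simp add: ip_def mult.commute)
  have ip_lin2: "ip k (\<lambda>x. c * f x + d * h x) = c * ip k f + d * ip k h" for c d f h k
    using ip_lin ip_com by metis
  have ip_pos: "ip f f \<ge> 0" for f by (simp add: ip_def sum_nonneg)
  have ip_cont: "continuous_on UNIV (\<lambda>f. ip f f)" "continuous_on UNIV (\<lambda>f. ip f (L f))"
    unfolding ip_def by (intro continuous_intros cont continuous_on_product_coordinates)+
  have scale: "(\<lambda>x. r * f x) \<in> V" if "f \<in> V" for f r using sub[OF that that, of r 0] by simp
  have Lscale: "L (\<lambda>x. r * f x) = (\<lambda>x. r * L f x)" for r f using lin[of r f 0 f] by simp
  have ipscale: "ip (\<lambda>x. r * f x) (\<lambda>x. s * h x) = r * s * ip f h" for r s f h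
    by (simp add: ip_def sum_distrib_left algebra_simps)
  define K where "K = V \<inter> {f. ip f f = 1}"
  have "closed {f. ip f f = 1}"
    by (intro closed_Collect_eq ip_cont continuous_on_const)
  then have "closed K" unfolding K_def using closed by blast
  moreover have "K \<subseteq> PiE UNIV (\<lambda>x. {(if x \<in> A then -1 else 0)..(if x \<in> A then 1 else 0)})"
  proof
    fix f assume f: "f \<in> K"
    have "\<bar>f x\<bar> \<le> 1" if "x \<in> A" for x
    proof -
      have "f x * f x \<le> ip f f" unfolding ip_def by (rule member_le_sum) (use that fin in auto)
      then have "(f x)\<^sup>2 \<le> 1" using f by (simp add: K_def power2_eq_square)
      then show ?thesis by (simp add: abs_square_le_1)
    qed
    then show "f \<in> PiE UNIV (\<lambda>x. {(if x \<in> A then -1 else 0)..(if x \<in> A then 1 else 0)})"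
      using f supp[of f] by (auto simp: K_def abs_le_iff minus_le_iff)
  qed
  ultimately have "compact K" using compact_function_box
    by (metis compact_Int_closed inf.absorb_iff2)
  have nrm: "(\<lambda>x. f x / sqrt (ip f f)) \<in> K" if "f \<in> V" "ip f f \<noteq> 0" for f
  proof -
    have "ip f f > 0" using ip_pos[of f] that by simp
    then show ?thesis
      using scale[OF that(1), of "1 / sqrt (ip f f)"] ipscale[of "1 / sqrt (ip f f)" f "1 / sqrt (ip f f)" f]
      by (simp add: K_def)
  qed
  have "K \<noteq> {}" using nrm f0 by (auto simp: ip_def)
  have "continuous_on K (\<lambda>f. ip f (L f))" by (rule continuous_on_subset[OF ip_cont(2)]) simp
  from continuous_attains_inf[OF \<open>compact K\<close> \<open>K \<noteq> {}\<close> this]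
  obtain v where v: "v \<in> K" and v_min: "\<And>f. f \<in> K \<Longrightarrow> ip v (L v) \<le> ip f (L f)"
    by blast
  define c where "c = ip v (L v)"
  have vV: "v \<in> V" and v1: "ip v v = 1" using v by (auto simp: K_def)
  \<comment> \<open>The bound extends from the unit sphere to \<open>V\<close> by homogeneity; a
    function of norm 0 vanishes on \<open>A\<close> and is treated separately.\<close>
  have min: "c * ip f f \<le> ip f (L f)" if f: "f \<in> V" for f
  proof (cases "ip f f = 0")
    case True
    then have "f x * f x = 0" if "x \<in> A" for x
      using that fin unfolding ip_def by (subst (asm) sum_nonneg_eq_0_iff) auto
    then have "ip f (L f) = 0" by (simp add: ip_def)
    then show ?thesis using True by simp
  next
    case False
    then have p: "ip f f > 0" using ip_pos[of f] by simp
    have "c \<le> ip (\<lambda>x. 1 / sqrt (ip f f) * f x) (L (\<lambda>x. 1 / sqrt (ip f f) * f x))"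
      using v_min[OF nrm[OF f False]] by (simp add: c_def)
    also have "\<dots> = ip f (L f) / ip f f" unfolding Lscale ipscale using p by simp
    finally show ?thesis using p by (simp add: field_simps)
  qed
  \<comment> \<open>The residual of the eigenvalue equation is itself the direction of variation: by
    symmetry, the part of \<open>ip w (L w) - c * ip w w\<close> linear in \<open>t\<close>, for
    \<open>w = v + t u\<close>, is \<open>2 * t * ip u u\<close>, which must vanish at a
    minimum.\<close>
  define u where "u = (\<lambda>x. 1 * L v x + (- c) * v x)"
  have uV: "u \<in> V" unfolding u_def using vV inv by (intro sub)
  have "ip u u = 0"
  proof (rule quadratic_nonneg_imp_linear_coeff_zero)
    fix t :: real
    let ?w = "\<lambda>x. 1 * v x + t * u x"
    have "ip ?w (L ?w) - c * ip ?w ?w =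
       t * (ip v (L u) + ip u (L v) - 2 * c * ip u v) + t\<^sup>2 * (ip u (L u) - c * ip u u)"
      unfolding lin ip_lin ip_lin2 c_def[symmetric] v1 ip_com[of v u]
      by (simp add: algebra_simps power2_eq_square)
    moreover have "ip v (L u) = ip u (L v)"
      using sym[OF vV uV] ip_com by (metis ip_def)
    moreover have "ip u u = ip u (L v) - c * ip u v"
      using ip_lin2[of u 1 "L v" "- c" v] unfolding u_def[symmetric] by simp
    ultimately have "ip ?w (L ?w) - c * ip ?w ?w = t * (2 * ip u u) + t\<^sup>2 * (ip u (L u) - c * ip u u)"
    proof -
      assume 1: "ip ?w (L ?w) - c * ip ?w ?w =
          t * (ip v (L u) + ip u (L v) - 2 * c * ip u v) + t\<^sup>2 * (ip u (L u) - c * ip u u)"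
        and "ip v (L u) = ip u (L v)" "ip u u = ip u (L v) - c * ip u v"
      then have "ip v (L u) + ip u (L v) - 2 * c * ip u v = 2 * ip u u" by linarith
      with 1 show ?thesis by (simp only:)
    qed
    then show "0 \<le> 2 * t * ip u u + t\<^sup>2 * (ip u (L u) - c * ip u u)"
      using min[OF sub[OF vV uV, of 1 t]] by (simp add: mult.left_commute mult.assoc)
  qed
  then have "u x * u x = 0" if "x \<in> A" for x
    using that fin unfolding ip_def by (subst (asm) sum_nonneg_eq_0_iff) auto
  then have "u x = 0" for x using supp[OF uV] by (cases "x \<in> A") auto
  then have "L v = (\<lambda>x. c * v x)" by (auto simp: u_def fun_eq_iff)
  then show ?thesis using that vV v1 min[OF f0(1)] by (simp add: ip_def)
qed

subsection \<open>The joint spectrum of the Jucys-Murphy operators\<close>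

text \<open>The contents (column minus row) of the boxes of a standard Young tableau, in the order
  of the entries, satisfy this, because every later box has an earlier neighbour to the left or
  above. The condition is weaker, as it admits the sequence 0, 0; it keeps what makes the Eulerian
  recurrence positive.\<close>

definition eulerian_content :: "nat \<Rightarrow> (nat \<Rightarrow> real) \<Rightarrow> bool" where
  "eulerian_content m a \<longleftrightarrow> (m \<ge> 1 \<longrightarrow> a 1 = 0) \<and> (\<forall>i\<in>{1..m}. a i \<in> \<int>) \<and>
     (\<forall>i\<in>{2..m}. (\<exists>j\<in>{1..<i}. a i \<le> a j + 1) \<and> (\<exists>j\<in>{1..<i}. a j - 1 \<le> a i))"

lemma eulerian_content_SucD:
  assumes "eulerian_content (Suc m) a"
  shows "eulerian_content m a"
  using assms by (auto simp: eulerian_content_def)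

lemma eulerian_prod_Suc:
  fixes a :: "nat \<Rightarrow> 'a::comm_ring_1"
  shows "eulerian (Suc m) (\<lambda>x. \<Prod>i\<in>{1..Suc m}. (of_nat x + a i)) (Suc k) =
    (of_nat (k + 1) + a (Suc m)) * eulerian m (\<lambda>x. \<Prod>i\<in>{1..m}. (of_nat x + a i)) (Suc k) +
    (of_nat (m + 1) - of_nat k - a (Suc m)) * eulerian m (\<lambda>x. \<Prod>i\<in>{1..m}. (of_nat x + a i)) k"
proof -
  have "(\<lambda>x. \<Prod>i\<in>{1..Suc m}. (of_nat x + a i)) =
      (\<lambda>x. (of_nat x + a (Suc m)) * (\<Prod>i\<in>{1..m}. (of_nat x + a i)))"
    by (simp add: fun_eq_iff mult.commute)
  then show ?thesis by (simp only: eulerian_mult_linear)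
qed

text \<open>
  The support condition is what makes both coefficients of the recurrence nonnegative where they
  matter: for the contents of a partition with r rows and c columns it reads
  \<open>r \<le> k \<le> m + 1 - c\<close>.
\<close>

lemma eulerian_content_nonneg:
  fixes a :: "nat \<Rightarrow> real"
  assumes "eulerian_content (Suc m) a"
  shows "eulerian (Suc m) (\<lambda>x. \<Prod>i\<in>{1..Suc m}. (real x + a i)) k \<ge> 0 \<and>
    (eulerian (Suc m) (\<lambda>x. \<Prod>i\<in>{1..Suc m}. (real x + a i)) k \<noteq> 0 \<longrightarrow>
      (\<forall>i\<in>{1..Suc m}. - a i < k \<and> k + a i \<le> Suc m))"
  using assms
proof (induction m arbitrary: k)
  case 0
  then have "a 1 = 0" by (auto simp: eulerian_content_def)
  moreover have "eulerian (Suc 0) (\<lambda>x. \<Prod>i\<in>{1..Suc 0}. (real x + a i)) (Suc k) = (if k = 0 then 1 + a 1 else if k = 1 then - a 1 else 0)" for k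
    unfolding eulerian_prod_Suc by (simp add: eulerian_constant)
  ultimately show ?case by (cases k) auto
next
  case (Suc m)
  let ?P = "\<lambda>m x. \<Prod>i\<in>{1..m}. (real x + a i)"
  have IH: "eulerian (Suc m) (?P (Suc m)) k \<ge> 0"
    "eulerian (Suc m) (?P (Suc m)) k \<noteq> 0 \<Longrightarrow> i \<in> {1..Suc m} \<Longrightarrow> - a i < k \<and> k + a i \<le> Suc m" for k i
    using Suc.IH[OF eulerian_content_SucD[OF Suc.prems], of k] by blast+
  show ?case
  proof (cases k)
    case (Suc k')
    define b where "b = a (Suc (Suc m))"
    define u where "u = eulerian (Suc m) (?P (Suc m)) (Suc k')"
    define v where "v = eulerian (Suc m) (?P (Suc m)) k'"
    have rec: "eulerian (Suc (Suc m)) (?P (Suc (Suc m))) k =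
        (real (k' + 1) + b) * u + (real (Suc m + 1) - real k' - b) * v"
      unfolding Suc u_def v_def b_def eulerian_prod_Suc ..
    have "b \<in> \<int>" using Suc.prems unfolding b_def eulerian_content_def by auto
    then obtain b' where b': "b = of_int b'" by (auto elim: Ints_cases)
    \<comment> \<open>strict inequalities between integers gain 1, hence the passage to \<open>int\<close>\<close>
    define a' where "a' i = \<lfloor>a i\<rfloor>" for i
    have "\<forall>i\<in>{1..Suc m}. a i \<in> \<int>" using Suc.prems unfolding eulerian_content_def by auto
    then have a': "i \<in> {1..Suc m} \<Longrightarrow> a i = of_int (a' i)" for i
      by (simp add: a'_def)
    have "Suc (Suc m) \<in> {2..Suc (Suc m)}" by simp
    then obtain i j where "i \<in> {1..<Suc (Suc m)}" "b \<le> a i + 1" "j \<in> {1..<Suc (Suc m)}" "a j - 1 \<le> b"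
      using Suc.prems unfolding b_def eulerian_content_def by meson
    then have i: "i \<in> {1..Suc m}" "b' \<le> a' i + 1" and j: "j \<in> {1..Suc m}" "a' j - 1 \<le> b'"
      using a'[of i] a'[of j] b' by auto
    have U: "- a' l < int k' + 1 \<and> int k' + 1 + a' l \<le> int m + 1" if "u \<noteq> 0" "l \<in> {1..Suc m}" for l
      using IH(2)[OF that[unfolded u_def]] a'[OF that(2)] by linarith
    have V: "- a' l < int k' \<and> int k' + a' l \<le> int m + 1" if "v \<noteq> 0" "l \<in> {1..Suc m}" for l
      using IH(2)[OF that[unfolded v_def]] a'[OF that(2)] by linarith
    have uv: "u \<ge> 0" "v \<ge> 0" using IH by (auto simp: u_def v_def)
    \<comment> \<open>If \<open>u\<close> is nonzero, the support condition at the earlier value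
      \<open>a j\<close> with \<open>a j - 1 \<le> b\<close> bounds the first coefficient below;
      \<open>s2\<close> argues likewise from \<open>a i\<close> with
      \<open>b \<le> a i + 1\<close>.\<close>
    have s1: "(real (k' + 1) + b) * u \<ge> 0"
    proof (cases "u = 0")
      case False
      then have "int k' + 1 + b' \<ge> 0" using U[OF _ j(1)] j(2) by linarith
      then have "real (k' + 1) + b \<ge> 0" using b' by linarith
      then show ?thesis using uv by simp
    qed simp
    have s2: "(real (Suc m + 1) - real k' - b) * v \<ge> 0"
    proof (cases "v = 0")
      case False
      then have "int m + 2 - int k' - b' \<ge> 0" using V[OF _ i(1)] i(2) by linarith
      then have "real (Suc m + 1) - real k' - b \<ge> 0" using b' by linarith
      then show ?thesis using uv by simp
    qed simp
    have "- a l < k \<and> k + a l \<le> Suc (Suc m)"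
      if nz: "(real (k' + 1) + b) * u + (real (Suc m + 1) - real k' - b) * v \<noteq> 0"
        and l: "l \<in> {1..Suc (Suc m)}" for l
    proof -
      \<comment> \<open>A nonzero sum has a nonzero summand. Its coefficient is then at least 1 as
        an integer, which is one of the two support bounds for \<open>b\<close>; the other follows
        from the earlier values.\<close>
      consider "u \<noteq> 0" "real (k' + 1) + b \<noteq> 0" | "v \<noteq> 0" "real (Suc m + 1) - real k' - b \<noteq> 0"
        using nz by fastforce
      then show ?thesis
      proof cases
        case 1
        then have "int k' + 1 + b' \<noteq> 0" using b' by linarith
        then have "- b' < int k' + 1 \<and> int k' + 1 + b' \<le> int m + 2"
          using U[OF 1(1) j(1)] U[OF 1(1) i(1)] i j by linarith
        then have "- b < k \<and> k + b \<le> Suc (Suc m)" unfolding Suc b' by linarith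
        moreover have "- a l < k \<and> k + a l \<le> Suc (Suc m)" if "l \<in> {1..Suc m}"
          using U[OF 1(1) that] a'[OF that] unfolding Suc by linarith
        ultimately show ?thesis using l by (cases "l = Suc (Suc m)") (auto simp: b_def)
      next
        case 2
        then have "int m + 2 - int k' - b' \<noteq> 0" using b' by linarith
        then have "- b' < int k' + 1 \<and> int k' + 1 + b' \<le> int m + 2"
          using V[OF 2(1) j(1)] V[OF 2(1) i(1)] i j by linarith
        then have "- b < k \<and> k + b \<le> Suc (Suc m)" unfolding Suc b' by linarith
        moreover have "- a l < k \<and> k + a l \<le> Suc (Suc m)" if "l \<in> {1..Suc m}"
          using V[OF 2(1) that] a'[OF that] unfolding Suc by linarith
        ultimately show ?thesis using l by (cases "l = Suc (Suc m)") (auto simp: b_def)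
      qed
    qed
    moreover have "(real (k' + 1) + b) * u + (real (Suc m + 1) - real k' - b) * v \<ge> 0"
      using s1 s2 by (rule add_nonneg_nonneg)
    ultimately show ?thesis unfolding rec by blast
  qed simp
qed

section \<open>Jucys-Murphy operators: commutation, symmetry and adjacent swaps\<close>

definition jucys_murphy :: "nat \<Rightarrow> ((nat \<Rightarrow> nat) \<Rightarrow> real) \<Rightarrow> (nat \<Rightarrow> nat) \<Rightarrow> real" where
  "jucys_murphy i f g = (\<Sum>l\<in>{1..<i}. f (g \<circ> Transposition.transpose l i))"

lemma transpose_conj:
  assumes "bij p"
  shows "p \<circ> Transposition.transpose a b = Transposition.transpose (p a) (p b) \<circ> p"
  using assms by (auto simp: fun_eq_iff Transposition.transpose_def bij_def inj_eq)

lemma jucys_murphy_lin: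
  "jucys_murphy i (\<lambda>x. c * f x + d * h x) = (\<lambda>x. c * jucys_murphy i f x + d * jucys_murphy i h x)"
  by (simp add: jucys_murphy_def fun_eq_iff sum.distrib sum_distrib_left)

text \<open>Conjugation by \<open>(l i)\<close> with \<open>l\<close> and \<open>i\<close> below
  \<open>j\<close> permutes the transpositions \<open>(k j)\<close>, \<open>1 \<le> k < j\<close>,
  among themselves.\<close>

lemma jucys_murphy_comp_transpose_commute:
  assumes l: "l < j" "i < j" "l \<ge> 1" "i \<ge> 1"
  shows "jucys_murphy j f (g \<circ> Transposition.transpose l i) =
    jucys_murphy j (\<lambda>g. f (g \<circ> Transposition.transpose l i)) g"
proof -
  let ?t = "Transposition.transpose l i"
  have "(\<Sum>k\<in>{1..<j}. f (g \<circ> ?t \<circ> Transposition.transpose k j)) =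
    (\<Sum>k\<in>{1..<j}. f (g \<circ> Transposition.transpose k j \<circ> ?t))"
  proof (rule sum.reindex_bij_witness[of _ ?t ?t])
    fix k assume k: "k \<in> {1..<j}"
    show "?t k \<in> {1..<j}" using k l by (auto simp: Transposition.transpose_def)
    have "?t j = j" using l by (simp add: Transposition.transpose_def)
    then have "?t \<circ> Transposition.transpose k j = Transposition.transpose (?t k) j \<circ> ?t"
      using transpose_conj[of ?t k j] by simp
    then show "f (g \<circ> Transposition.transpose (?t k) j \<circ> ?t) = f (g \<circ> ?t \<circ> Transposition.transpose k j)"
      by (simp add: comp_assoc)
  qed (use l in \<open>auto simp: Transposition.transpose_def\<close>)
  then show ?thesis by (simp add: jucys_murphy_def)
qed

lemma jucys_murphy_commute_less:
  assumes "i < j"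
  shows "jucys_murphy i (jucys_murphy j f) = jucys_murphy j (jucys_murphy i f)"
proof
  fix g
  have "jucys_murphy i (jucys_murphy j f) g =
     (\<Sum>l\<in>{1..<i}. jucys_murphy j (\<lambda>g. f (g \<circ> Transposition.transpose l i)) g)"
    unfolding jucys_murphy_def[of i]
    by (intro sum.cong refl jucys_murphy_comp_transpose_commute) (use assms in auto)
  also have "\<dots> = jucys_murphy j (jucys_murphy i f) g"
    unfolding jucys_murphy_def by (rule sum.swap)
  finally show "jucys_murphy i (jucys_murphy j f) g = jucys_murphy j (jucys_murphy i f) g" .
qed

lemma jucys_murphy_commute: "jucys_murphy i (jucys_murphy j f) = jucys_murphy j (jucys_murphy i f)"
  by (metis jucys_murphy_commute_less linorder_neqE_nat)

text \<open>A transposition is an involution, so translation by it is its own adjoint.\<close>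

lemma jucys_murphy_symmetric:
  assumes "i \<le> n"
  shows "(\<Sum>g | g permutes {1..n}. jucys_murphy i f g * h g) =
    (\<Sum>g | g permutes {1..n}. f g * jucys_murphy i h g)"
proof -
  have "(\<Sum>g | g permutes {1..n}. f (g \<circ> Transposition.transpose l i) * h g) =
    (\<Sum>g | g permutes {1..n}. f g * h (g \<circ> Transposition.transpose l i))" if "l \<in> {1..<i}" for l
  proof -
    have t: "Transposition.transpose l i permutes {1..n}"
      using that assms by (intro permutes_swap_id) auto
    show ?thesis by (subst sum_permutations_compose_right[OF t]) (simp add: comp_assoc)
  qed
  then have "(\<Sum>l\<in>{1..<i}. \<Sum>g | g permutes {1..n}. f (g \<circ> Transposition.transpose l i) * h g) =
    (\<Sum>l\<in>{1..<i}. \<Sum>g | g permutes {1..n}. f g * h (g \<circ> Transposition.transpose l i))" by simp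
  then show ?thesis
    unfolding jucys_murphy_def sum_distrib_left sum_distrib_right
    by (subst (1 2) sum.swap)
qed

lemma jucys_murphy_supported:
  assumes "\<And>g. \<not> g permutes {1..n} \<Longrightarrow> f g = 0" "i \<le> n" "\<not> g permutes {1..n}"
  shows "jucys_murphy i f g = 0"
  unfolding jucys_murphy_def
proof (intro sum.neutral ballI assms(1) notI)
  fix l assume l: "l \<in> {1..<i}" and "g \<circ> Transposition.transpose l i permutes {1..n}"
  moreover have "Transposition.transpose l i permutes {1..n}"
    using l assms by (intro permutes_swap_id) auto
  ultimately have "g \<circ> Transposition.transpose l i \<circ> Transposition.transpose l i permutes {1..n}"
    by (metis permutes_compose)
  then show False using assms(3) by (simp add: comp_assoc)
qed

text \<open>Conjugation by \<open>(m, m + 1)\<close> turns \<open>(l, m)\<close> into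
  \<open>(l, m + 1)\<close> for \<open>l < m\<close>; the summand \<open>(m, m + 1)\<close> itself
  cancels the swap and leaves \<open>f g\<close>. This is a defining relation of the degenerate
  affine Hecke algebra.\<close>

lemma jucys_murphy_swap:
  assumes "m \<ge> 1"
  shows "jucys_murphy (Suc m) (\<lambda>g. f (g \<circ> Transposition.transpose m (Suc m))) g =
    jucys_murphy m f (g \<circ> Transposition.transpose m (Suc m)) + f g"
proof -
  let ?s = "Transposition.transpose m (Suc m)"
  have "Transposition.transpose l (Suc m) \<circ> ?s = ?s \<circ> Transposition.transpose l m" if "l < m" for l
    using transpose_conj[of ?s l m] that by (simp add: Transposition.transpose_def)
  then have "(\<Sum>l\<in>{1..<m}. f (g \<circ> Transposition.transpose l (Suc m) \<circ> ?s)) =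
      (\<Sum>l\<in>{1..<m}. f (g \<circ> ?s \<circ> Transposition.transpose l m))"
    by (intro sum.cong) (auto simp: comp_assoc)
  then show ?thesis using assms by (simp add: jucys_murphy_def comp_assoc sum.atLeastLessThan_Suc)
qed

lemma jucys_murphy_swap':
  assumes "m \<ge> 1"
  shows "jucys_murphy m (\<lambda>g. f (g \<circ> Transposition.transpose m (Suc m))) g =
    jucys_murphy (Suc m) f (g \<circ> Transposition.transpose m (Suc m)) - f g"
  using jucys_murphy_swap[OF assms, of "\<lambda>g. f (g \<circ> Transposition.transpose m (Suc m))"
      "g \<circ> Transposition.transpose m (Suc m)"]
  by (simp add: comp_assoc)

lemma jucys_murphy_swap_other:
  assumes "i < m"
  shows "jucys_murphy i (\<lambda>g. f (g \<circ> Transposition.transpose m (Suc m))) g =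
    jucys_murphy i f (g \<circ> Transposition.transpose m (Suc m))"
proof -
  let ?s = "Transposition.transpose m (Suc m)"
  have "Transposition.transpose l i \<circ> ?s = ?s \<circ> Transposition.transpose l i" if "l < i" for l
    using transpose_conj[of ?s l i] that assms by (simp add: Transposition.transpose_def)
  then show ?thesis by (simp add: jucys_murphy_def comp_assoc)
qed

text \<open>The ambient \<open>n\<close> is separate from the number \<open>m\<close> of operators,
  so that operators can be added one at a time and the swapped vector can be an eigenvector for
  fewer of them.\<close>

definition joint_eigenvector :: "nat \<Rightarrow> nat \<Rightarrow> (nat \<Rightarrow> real) \<Rightarrow> ((nat \<Rightarrow> nat) \<Rightarrow> real) \<Rightarrow> bool" where
  "joint_eigenvector n m a v \<longleftrightarrow> (\<forall>g. \<not> g permutes {1..n} \<longrightarrow> v g = 0) \<and> (\<exists>g. v g \<noteq> 0) \<and>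
     (\<forall>i\<in>{1..m}. \<forall>g. jucys_murphy i v g = a i * v g)"

text \<open>
  Unless the last two eigenvalues differ by 1, an adjacent transposition produces a joint eigenvector
  with these two exchanged. This reduces the constraints on the last eigenvalue to those on the one
  before it.
\<close>

lemma jucys_murphy_swap_vector:
  assumes v: "joint_eigenvector n (Suc m) a v" and m: "1 \<le> m" "Suc m \<le> n"
    and d: "d = a (Suc m) - a m" "d \<noteq> 0" "d\<^sup>2 \<noteq> 1"
  shows "joint_eigenvector n m (a(m := a (Suc m)))
    (\<lambda>g. 1 * v (g \<circ> Transposition.transpose m (Suc m)) + (- 1 / d) * v g)"
proof -
  let ?s = "Transposition.transpose m (Suc m)"
  let ?w = "\<lambda>g. 1 * v (g \<circ> ?s) + (- 1 / d) * v g"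
  have supp: "\<not> g permutes {1..n} \<Longrightarrow> v g = 0" for g using v by (auto simp: joint_eigenvector_def)
  have eig: "i \<in> {1..Suc m} \<Longrightarrow> jucys_murphy i v g = a i * v g" for i g
    using v by (auto simp: joint_eigenvector_def)
  obtain g0 where g0: "v g0 \<noteq> 0" using v by (auto simp: joint_eigenvector_def)
  have s: "?s permutes {1..n}" using m by (intro permutes_swap_id) auto
  have "?w g = 0" if g: "\<not> g permutes {1..n}" for g
  proof -
    have "g \<circ> ?s \<circ> ?s = g" by (simp add: comp_assoc)
    then have "\<not> (g \<circ> ?s) permutes {1..n}" using g permutes_compose[OF s, of "g \<circ> ?s"] by metis
    then show ?thesis using g supp by simp
  qed
  moreover have "\<exists>g. ?w g \<noteq> 0"
  proof (rule ccontr)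
    \<comment> \<open>If the new vector vanished, the swap would multiply \<open>v\<close> by
      \<open>1 / d\<close>; as the swap is an involution, this forces
      \<open>d\<^sup>2 = 1\<close>.\<close>
    assume "\<not> (\<exists>g. ?w g \<noteq> 0)"
    then have w: "v (g \<circ> ?s) = v g / d" for g by (simp add: add_eq_0_iff divide_inverse mult.commute)
    have "v g0 = v (g0 \<circ> ?s \<circ> ?s)" by (simp add: comp_assoc)
    also have "\<dots> = v g0 / d\<^sup>2" unfolding w by (simp add: power2_eq_square)
    finally show False using g0 d(2,3) by (simp add: field_simps)
  qed
  moreover have "jucys_murphy i ?w g = (a(m := a (Suc m))) i * ?w g" if i: "i \<in> {1..m}" for i g
  proof (cases "i = m")
    case True
    have "jucys_murphy m (\<lambda>g. v (g \<circ> ?s)) g = a (Suc m) * v (g \<circ> ?s) - v g"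
      unfolding jucys_murphy_swap'[OF m(1)] using eig m by simp
    then have "jucys_murphy m ?w g = a (Suc m) * v (g \<circ> ?s) - v g - 1 / d * (a m * v g)"
      unfolding jucys_murphy_lin using eig m by simp
    \<comment> \<open>This is what fixes the coefficient \<open>- 1 / d\<close>: it makes
      \<open>1 + a m / d = a (Suc m) / d\<close>.\<close>
    also have "\<dots> = a (Suc m) * ?w g"
    proof -
      have "a (Suc m) = d + a m" using d(1) by simp
      then show ?thesis using d(2) by (simp add: field_simps)
    qed
    finally show ?thesis using True by simp
  next
    case False
    then have "i < m" using i by auto
    then show ?thesis
      unfolding jucys_murphy_lin jucys_murphy_swap_other[OF \<open>i < m\<close>] using eig i by (simp add: algebra_simps)
  qed
  ultimately show ?thesis unfolding joint_eigenvector_def by blast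
qed


text \<open>For equal eigenvalues the operator with index \<open>Suc m\<close> would send the
  swapped vector to \<open>a m\<close> times itself plus \<open>v\<close>, a Jordan block. Pairing
  with \<open>v\<close> and using symmetry gives \<open>v = 0\<close>.\<close>

lemma jucys_murphy_separated:
  assumes v: "joint_eigenvector n (Suc m) a v" and m: "1 \<le> m" "Suc m \<le> n"
  shows "a (Suc m) \<noteq> a m"
proof
  let ?s = "Transposition.transpose m (Suc m)"
  let ?ip = "\<lambda>f h. \<Sum>g | g permutes {1..n}. f g * h g :: real"
  assume eq: "a (Suc m) = a m"
  have supp: "\<not> g permutes {1..n} \<Longrightarrow> v g = 0" for g using v by (auto simp: joint_eigenvector_def)
  have eig: "i \<in> {1..Suc m} \<Longrightarrow> jucys_murphy i v g = a i * v g" for i g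
    using v by (auto simp: joint_eigenvector_def)
  obtain g0 where g0: "v g0 \<noteq> 0" using v by (auto simp: joint_eigenvector_def)
  have "?ip (jucys_murphy (Suc m) (\<lambda>g. v (g \<circ> ?s))) v = ?ip (\<lambda>g. v (g \<circ> ?s)) (jucys_murphy (Suc m) v)"
    using m by (intro jucys_murphy_symmetric)
  then have "?ip (\<lambda>g. a m * v (g \<circ> ?s) + v g) v = ?ip (\<lambda>g. v (g \<circ> ?s)) (\<lambda>g. a m * v g)"
    unfolding jucys_murphy_swap[OF m(1)] using eig m eq by simp
  then have "?ip v v = 0"
    by (simp add: algebra_simps sum.distrib)
  moreover have "finite {g. g permutes {1..n}}" by (simp add: finite_permutations)
  moreover have "g0 permutes {1..n}" using g0 supp by blast
  ultimately show False using g0 by (simp add: sum_nonneg_eq_0_iff)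
qed

text \<open>Induction on \<open>m\<close> for all eigenvectors at once. If the last two eigenvalues
  differ by 1, the index \<open>m\<close> witnesses both bounds. Otherwise swapping puts
  \<open>b\<close> in position \<open>m\<close>, and the induction hypothesis bounds it by the
  values before that position, which the swap does not touch.\<close>

lemma joint_eigenvector_content:
  assumes "joint_eigenvector n m a v" "m \<le> n"
  shows "eulerian_content m a"
  using assms
proof (induction m arbitrary: a v)
  case 0
  then show ?case by (simp add: eulerian_content_def)
next
  case (Suc m)
  have "joint_eigenvector n m a v" using Suc.prems(1) by (auto simp: joint_eigenvector_def)
  then have c: "eulerian_content m a" using Suc by simp
  show ?case
  proof (cases "m = 0")
    case True
    have "jucys_murphy 1 v g = a 1 * v g" for g
      using Suc.prems(1) by (auto simp: joint_eigenvector_def)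
    moreover have "\<exists>g. v g \<noteq> 0" using Suc.prems(1) by (auto simp: joint_eigenvector_def)
    ultimately have "a 1 = 0" by (auto simp: jucys_murphy_def)
    then show ?thesis using True by (simp add: eulerian_content_def)
  next
    case False
    define b where "b = a (Suc m)"
    have "b \<in> \<int> \<and> (\<exists>j\<in>{1..<Suc m}. b \<le> a j + 1) \<and> (\<exists>j\<in>{1..<Suc m}. a j - 1 \<le> b)"
    proof (cases "(b - a m)\<^sup>2 = 1")
      case True
      then have b: "b = a m + 1 \<or> b = a m - 1" by (auto simp: power2_eq_1_iff)
      have "a m \<in> \<int>" using c False by (auto simp: eulerian_content_def)
      moreover have "m \<in> {1..<Suc m}" using False by auto
      ultimately show ?thesis using b by (intro conjI bexI[of _ m]) auto
    next
      case neq: False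
      have "b \<noteq> a m"
        using jucys_murphy_separated[OF Suc.prems(1)] False Suc.prems(2) by (simp add: b_def)
      then have "b - a m \<noteq> 0" by simp
      from Suc.IH[OF jucys_murphy_swap_vector[OF Suc.prems(1) _ _ _ this neq]]
      have "eulerian_content m (a(m := b))"
        using False Suc.prems(2) unfolding b_def by linarith
      \<comment> \<open>For \<open>m = 1\<close> both \<open>a m\<close> and \<open>b\<close> would
        be eigenvalues of the first operator, an empty sum, hence 0.\<close>
      moreover have "m \<noteq> 1"
      proof
        assume "m = 1"
        then have "b = 0" "a m = 0" using calculation c by (auto simp: eulerian_content_def)
        then show False using \<open>b \<noteq> a m\<close> by simp
      qed
      moreover have "m \<in> {2..m}" "m \<in> {1..m}" using False \<open>m \<noteq> 1\<close> by auto
      ultimately have *: "(a(m := b)) m \<in> \<int>"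
        "\<exists>j\<in>{1..<m}. (a(m := b)) m \<le> (a(m := b)) j + 1" "\<exists>j\<in>{1..<m}. (a(m := b)) j - 1 \<le> (a(m := b)) m"
        unfolding eulerian_content_def by blast+
      have "(a(m := b)) j = a j" if "j \<in> {1..<m}" for j using that by simp
      then have "b \<in> \<int>" "\<exists>j\<in>{1..<m}. b \<le> a j + 1" "\<exists>j\<in>{1..<m}. a j - 1 \<le> b"
        using * by (auto split: if_splits)
      then show ?thesis by force
    qed
    then have "a i \<in> \<int> \<and> (\<exists>j\<in>{1..<i}. a i \<le> a j + 1) \<and> (\<exists>j\<in>{1..<i}. a j - 1 \<le> a i)" if "i = Suc m" for i
      using that by (simp add: b_def)
    with c show ?thesis
      unfolding eulerian_content_def using False by (simp add: atLeastAtMostSuc_conv)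
  qed
qed

subsection \<open>Central convolution operators\<close>

text \<open>With \<open>h = g \<circ> p\<close> this is the operator with kernel
  \<open>w (inv' g \<circ> h)\<close>, so nonnegativity of its quadratic form expresses positive
  definiteness of \<open>w\<close>.\<close>

definition right_conv :: "nat \<Rightarrow> ((nat \<Rightarrow> nat) \<Rightarrow> real) \<Rightarrow> ((nat \<Rightarrow> nat) \<Rightarrow> real) \<Rightarrow> (nat \<Rightarrow> nat) \<Rightarrow> real" where
  "right_conv n w f g = (\<Sum>p | p permutes {1..n}. w p * f (g \<circ> p))"

lemma right_conv_lin:
  "right_conv n w (\<lambda>x. c * f x + d * h x) = (\<lambda>x. c * right_conv n w f x + d * right_conv n w h x)"
  by (simp add: right_conv_def fun_eq_iff sum.distrib sum_distrib_left algebra_simps)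

lemma continuous_right_conv: "continuous_on UNIV (\<lambda>f. right_conv n w f g)"
  unfolding right_conv_def by (intro continuous_intros continuous_on_product_coordinates)

lemma continuous_jucys_murphy: "continuous_on UNIV (\<lambda>f. jucys_murphy i f g)"
  unfolding jucys_murphy_def by (intro continuous_intros continuous_on_product_coordinates)

lemma right_conv_supported:
  assumes "\<And>g. \<not> g permutes {1..n} \<Longrightarrow> f g = 0" "\<not> g permutes {1..n}"
  shows "right_conv n w f g = 0"
  unfolding right_conv_def
proof (rule sum.neutral, intro ballI)
  fix p assume "p \<in> {p. p permutes {1..n}}"
  then have p: "p permutes {1..n}" by simp
  have "g \<circ> p \<circ> inv' p = g" using permutes_inv_o(1)[OF p] by (simp add: comp_assoc)
  then have "\<not> (g \<circ> p) permutes {1..n}"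
    using assms(2) permutes_compose[OF permutes_inv[OF p], of "g \<circ> p"] by metis
  then show "w p * f (g \<circ> p) = 0" using assms(1) by simp
qed

text \<open>Translation by \<open>p\<close> has translation by \<open>inv' p\<close> as its adjoint,
  and the two carry the same weight.\<close>

lemma right_conv_symmetric:
  assumes w: "\<And>p. p permutes {1..n} \<Longrightarrow> w (inv' p) = w p"
  shows "(\<Sum>g | g permutes {1..n}. right_conv n w f g * h g) =
    (\<Sum>g | g permutes {1..n}. f g * right_conv n w h g)"
proof -
  have inner: "(\<Sum>g | g permutes {1..n}. f (g \<circ> p) * h g) = (\<Sum>g | g permutes {1..n}. f g * h (g \<circ> inv' p))"
    if p: "p permutes {1..n}" for p
    by (subst sum_permutations_compose_right[OF permutes_inv[OF p]])
      (simp add: comp_assoc permutes_inv_o[OF p])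
  have "(\<Sum>g | g permutes {1..n}. right_conv n w f g * h g) =
      (\<Sum>p | p permutes {1..n}. \<Sum>g | g permutes {1..n}. w p * (f (g \<circ> p) * h g))"
    unfolding right_conv_def sum_distrib_right by (subst sum.swap) (simp add: mult.assoc)
  also have "\<dots> = (\<Sum>p | p permutes {1..n}. w p * (\<Sum>g | g permutes {1..n}. f g * h (g \<circ> inv' p)))"
    by (intro sum.cong refl) (simp only: sum_distrib_left[symmetric] inner mem_Collect_eq)
  also have "\<dots> = (\<Sum>p | p permutes {1..n}. w (inv' p) * (\<Sum>g | g permutes {1..n}. f g * h (g \<circ> inv' (inv' p))))"
    by (rule sum_permutations_inverse)
  also have "\<dots> = (\<Sum>p | p permutes {1..n}. w p * (\<Sum>g | g permutes {1..n}. f g * h (g \<circ> p)))"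
    by (intro sum.cong refl) (simp only: w permutes_inv_inv mem_Collect_eq)
  also have "\<dots> = (\<Sum>g | g permutes {1..n}. f g * right_conv n w h g)"
    unfolding right_conv_def sum_distrib_left by (subst sum.swap) (simp add: mult.left_commute)
  finally show ?thesis .
qed

text \<open>Conjugating the summation variable by a transposition leaves the weights of a class
  function unchanged.\<close>

lemma right_conv_jucys_murphy_commute:
  assumes w: "\<And>p q. p permutes {1..n} \<Longrightarrow> q permutes {1..n} \<Longrightarrow> w (q \<circ> p \<circ> inv' q) = w p"
    and i: "i \<le> n"
  shows "right_conv n w (jucys_murphy i f) = jucys_murphy i (right_conv n w f)"
proof
  fix g
  have "(\<Sum>p | p permutes {1..n}. w p * f (g \<circ> p \<circ> Transposition.transpose l i)) =
      right_conv n w f (g \<circ> Transposition.transpose l i)" if "l \<in> {1..<i}" for l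
  proof -
    let ?t = "Transposition.transpose l i"
    have t: "?t permutes {1..n}" using that i by (intro permutes_swap_id) auto
    have tt: "?t \<circ> (?t \<circ> q) = q" for q by (simp flip: comp_assoc)
    show ?thesis unfolding right_conv_def
    proof (rule sum.reindex_bij_witness[of _ "\<lambda>p. ?t \<circ> p \<circ> ?t" "\<lambda>p. ?t \<circ> p \<circ> ?t"])
      fix p assume "p \<in> {p. p permutes {1..n}}"
      then have p: "p permutes {1..n}" by simp
      have "w (?t \<circ> p \<circ> ?t) = w p" using w[OF p t] by simp
      then show "w (?t \<circ> p \<circ> ?t) * f (g \<circ> ?t \<circ> (?t \<circ> p \<circ> ?t)) = w p * f (g \<circ> p \<circ> ?t)"
        by (simp add: comp_assoc tt)
      show "?t \<circ> p \<circ> ?t \<in> {p. p permutes {1..n}}" using p t by (simp add: permutes_compose del: One_nat_def)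
    qed (simp_all add: comp_assoc tt permutes_compose t del: One_nat_def)
  qed
  then have "(\<Sum>l\<in>{1..<i}. \<Sum>p | p permutes {1..n}. w p * f (g \<circ> p \<circ> Transposition.transpose l i)) =
      jucys_murphy i (right_conv n w f) g"
    unfolding jucys_murphy_def by simp
  then show "right_conv n w (jucys_murphy i f) g = jucys_murphy i (right_conv n w f) g"
    unfolding right_conv_def[of n w "jucys_murphy i f"] jucys_murphy_def[of i f] sum_distrib_left
    by (subst (asm) sum.swap)
qed

lemma closed_joint_eigenspace:
  fixes Q :: "(nat \<Rightarrow> nat) \<Rightarrow> bool"
  shows "closed {f. (\<forall>g. Q g \<longrightarrow> f g = 0) \<and> (\<forall>g. right_conv n w f g = c * f g) \<and>
    (\<forall>i\<in>{1..m}. \<forall>g. jucys_murphy i f g = a i * f g)}"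
proof -
  have eq: "{f. (\<forall>g. Q g \<longrightarrow> f g = 0) \<and> (\<forall>g. right_conv n w f g = c * f g) \<and>
    (\<forall>i\<in>{1..m}. \<forall>g. jucys_murphy i f g = a i * f g)} =
    (\<Inter>g\<in>{g. Q g}. {f. f g = 0}) \<inter> (\<Inter>g. {f. right_conv n w f g = c * f g}) \<inter>
    (\<Inter>i\<in>{1..m}. \<Inter>g. {f. jucys_murphy i f g = a i * f g})" by auto
  show ?thesis unfolding eq
    by (intro closed_Int closed_INT ballI closed_Collect_eq continuous_right_conv continuous_jucys_murphy
        continuous_on_mult continuous_on_const continuous_on_product_coordinates)
qed

lemma sum_squares_permutations_eq_0_iff:
  fixes v :: "(nat \<Rightarrow> nat) \<Rightarrow> real"
  assumes "\<And>g. \<not> g permutes {1..n} \<Longrightarrow> v g = 0"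
  shows "(\<Sum>g | g permutes {1..n}. v g * v g) \<noteq> 0 \<longleftrightarrow> (\<exists>g. v g \<noteq> 0)"
proof -
  have "finite {g. g permutes {1..n}}" by (simp add: finite_permutations)
  then show ?thesis using assms by (auto simp: sum_nonneg_eq_0_iff)
qed

text \<open>Simultaneous diagonalization, one operator at a time: the common eigenspace found so far
  is closed and, by commutativity, invariant under the next Jucys-Murphy operator, so it contains an
  eigenvector of it. The eigenvalue \<open>c\<close> of the convolution is kept throughout.\<close>

lemma central_conv_joint_eigenvector:
  assumes conj: "\<And>p q. p permutes {1..n} \<Longrightarrow> q permutes {1..n} \<Longrightarrow> w (q \<circ> p \<circ> inv' q) = w p"
    and eig: "joint_eigenvector n 0 a0 v0" "\<And>g. right_conv n w v0 g = c * v0 g"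
    and m: "m \<le> n"
  shows "\<exists>a v. joint_eigenvector n m a v \<and> (\<forall>g. right_conv n w v g = c * v g)"
  using m
proof (induction m)
  case 0
  then show ?case using eig by blast
next
  case (Suc m)
  then obtain a v where v: "joint_eigenvector n m a v" "\<forall>g. right_conv n w v g = c * v g" by auto
  let ?J = "jucys_murphy (Suc m)"
  let ?V = "{f. (\<forall>g. \<not> g permutes {1..n} \<longrightarrow> f g = 0) \<and> (\<forall>g. right_conv n w f g = c * f g) \<and>
    (\<forall>i\<in>{1..m}. \<forall>g. jucys_murphy i f g = a i * f g)}"
  have Jscale: "jucys_murphy i (\<lambda>g. r * f g) = (\<lambda>g. r * jucys_murphy i f g)" for i r f
    using jucys_murphy_lin[of i r f 0 f] by simp
  have inv: "?J f \<in> ?V" if f: "f \<in> ?V" for f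
  proof -
    have "right_conv n w f = (\<lambda>g. c * f g)" using f by (simp add: fun_eq_iff)
    then have "right_conv n w (?J f) g = c * ?J f g" for g
      using right_conv_jucys_murphy_commute[of n w "Suc m" f] conj Suc.prems Jscale by simp
    moreover have "jucys_murphy i (?J f) g = a i * ?J f g" if "i \<in> {1..m}" for i g
    proof -
      have "jucys_murphy i f = (\<lambda>g. a i * f g)" using f that by (simp add: fun_eq_iff)
      then show ?thesis using jucys_murphy_commute[of i "Suc m" f] Jscale by simp
    qed
    moreover have "?J f g = 0" if "\<not> g permutes {1..n}" for g
      using f by (intro jucys_murphy_supported[OF _ Suc.prems that]) auto
    ultimately show ?thesis by simp
  qed
  have "v \<in> ?V" "(\<Sum>g | g permutes {1..n}. v g * v g) \<noteq> 0"
    using v sum_squares_permutations_eq_0_iff[of n v] by (auto simp: joint_eigenvector_def)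
  note nonzero = this
  obtain v' c' where v': "v' \<in> ?V" "(\<Sum>g | g permutes {1..n}. v' g * v' g) \<noteq> 0"
      "?J v' = (\<lambda>x. c' * v' x)"
  proof (rule symmetric_operator_eigenvector[where A = "{g. g permutes {1..n}}" and V = ?V and L = ?J
        and ?f0.0 = v, OF _ closed_joint_eigenspace _ _ jucys_murphy_lin continuous_jucys_murphy
        inv jucys_murphy_symmetric[OF Suc.prems] nonzero])
    show "(\<lambda>x. r * f x + s * h x) \<in> ?V" if "f \<in> ?V" "h \<in> ?V" for f h r s
      using that by (auto simp: jucys_murphy_lin right_conv_lin algebra_simps)
  qed (use that in \<open>auto simp: finite_permutations\<close>)
  have "joint_eigenvector n (Suc m) (a(Suc m := c')) v'"
    using v' sum_squares_permutations_eq_0_iff[of n v']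
    by (auto simp: joint_eigenvector_def fun_eq_iff le_Suc_eq)
  then show ?case using v'(1) by blast
qed

text \<open>If the form takes a negative value, the minimum of the Rayleigh quotient is a negative
  eigenvalue. Refining its eigenvector to a joint one contradicts \<open>eig\<close>.\<close>

lemma central_conv_nonneg:
  assumes conj: "\<And>p q. p permutes {1..n} \<Longrightarrow> q permutes {1..n} \<Longrightarrow> w (q \<circ> p \<circ> inv' q) = w p"
    and inv: "\<And>p. p permutes {1..n} \<Longrightarrow> w (inv' p) = w p"
    and eig: "\<And>a v c. joint_eigenvector n n a v \<Longrightarrow> (\<And>g. right_conv n w v g = c * v g) \<Longrightarrow> c \<ge> 0"
  shows "(\<Sum>g | g permutes {1..n}. f g * right_conv n w f g) \<ge> 0"
proof (rule ccontr)
  assume neg: "\<not> (\<Sum>g | g permutes {1..n}. f g * right_conv n w f g) \<ge> 0"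
  let ?V = "{f :: (nat \<Rightarrow> nat) \<Rightarrow> real. (\<forall>g. \<not> g permutes {1..n} \<longrightarrow> f g = 0)}"
  \<comment> \<open>The form sees \<open>f\<close> only on the group; cutting \<open>f\<close> off
    there puts it into \<open>?V\<close>.\<close>
  define h where "h g = (if g permutes {1..n} then f g else 0)" for g
  have "right_conv n w h g = right_conv n w f g" if "g permutes {1..n}" for g
    using that by (auto simp: right_conv_def h_def permutes_compose intro!: sum.cong)
  then have hneg: "(\<Sum>g | g permutes {1..n}. h g * right_conv n w h g) < 0"
    using neg by (simp add: h_def)
  then have "\<exists>g. h g \<noteq> 0" by (metis (no_types, lifting) mult_zero_left sum.neutral less_irrefl)
  then have "h \<in> ?V" "(\<Sum>g | g permutes {1..n}. h g * h g) \<noteq> 0"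
    using sum_squares_permutations_eq_0_iff[of n h] by (auto simp: h_def)
  note nonzero = this
  have "?V = (\<Inter>g\<in>{g. \<not> g permutes {1..n}}. {f. f g = 0})" by auto
  then have closed: "closed ?V"
    by (simp only:) (intro closed_INT ballI closed_Collect_eq continuous_on_const continuous_on_product_coordinates)
  obtain v c where v: "v \<in> ?V" "(\<Sum>g | g permutes {1..n}. v g * v g) \<noteq> 0"
      "right_conv n w v = (\<lambda>x. c * v x)"
      "c * (\<Sum>g | g permutes {1..n}. h g * h g) \<le> (\<Sum>g | g permutes {1..n}. h g * right_conv n w h g)"
  proof (rule symmetric_operator_eigenvector[where A = "{g. g permutes {1..n}}" and V = ?V and L = "right_conv n w"
        and ?f0.0 = h, OF _ closed _ _ right_conv_lin continuous_right_conv
        _ right_conv_symmetric[where n = n and w = w, OF inv] nonzero])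
    show "right_conv n w f \<in> ?V" if "f \<in> ?V" for f
      using that right_conv_supported[of n f] by blast
  qed (use that in \<open>auto simp: finite_permutations\<close>)
  have "joint_eigenvector n 0 (\<lambda>_. 0) v"
    using v sum_squares_permutations_eq_0_iff[of n v] by (auto simp: joint_eigenvector_def)
  then obtain a v' where "joint_eigenvector n n a v'" "\<forall>g. right_conv n w v' g = c * v' g"
    using central_conv_joint_eigenvector[of n w _ v c n] conj v(3) by (metis order_refl)
  then have "c \<ge> 0" using eig by blast
  moreover have "(\<Sum>g | g permutes {1..n}. h g * h g) \<ge> 0" by (simp add: sum_nonneg)
  ultimately show False using v(4) hneg by (smt (verit) mult_nonneg_nonneg)
qed

section \<open>The spectrum of convolution with powers of the number of cycles\<close>

lemma eulerian_linear_sum: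
  fixes p :: "'b \<Rightarrow> nat \<Rightarrow> 'a::comm_ring_1"
  shows "(\<Sum>i\<in>I. eulerian m (p i) k * c i) = eulerian m (\<lambda>x. \<Sum>i\<in>I. p i x * c i) k"
  unfolding eulerian_def sum_distrib_left sum_distrib_right
  by (subst sum.swap) (simp add: mult.assoc)

text \<open>Jucys' factorization. A permutation of \<open>{1..Suc m}\<close> is uniquely
  \<open>q\<close> or \<open>(Suc m b) \<circ> q\<close> with \<open>q\<close> permuting
  \<open>{1..m}\<close>. The first kind gains the cycle of \<open>Suc m\<close>, hence a factor
  \<open>t\<close>; the second keeps the number of cycles, and its translations summed over
  \<open>b\<close> form \<open>jucys_murphy (Suc m)\<close>.\<close>

lemma sum_cycle_powers_joint_eigenvector:
  assumes "joint_eigenvector n m a v"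
  shows "(\<Sum>p | p permutes {1..m}. t ^ num_cycles m p * v (g \<circ> p)) = (\<Prod>i\<in>{1..m}. (t + a i)) * v g"
  using assms
proof (induction m arbitrary: g)
  case 0
  show ?case by (simp add: num_cycles_def)
next
  case (Suc m)
  let ?w = "\<lambda>g. \<Sum>p | p permutes {1..m}. t ^ num_cycles m p * v (g \<circ> p)"
  have ev: "joint_eigenvector n m a v" using Suc.prems by (auto simp: joint_eigenvector_def)
  have J: "jucys_murphy (Suc m) v g = a (Suc m) * v g" using Suc.prems by (auto simp: joint_eigenvector_def)
  have ins: "{1..Suc m} = insert (Suc m) {1..m}" by auto
  have "(\<Sum>p | p permutes {1..Suc m}. t ^ num_cycles (Suc m) p * v (g \<circ> p)) =
     (\<Sum>q | q permutes {1..m}. t ^ num_cycles (Suc m) q * v (g \<circ> q)) +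
     (\<Sum>b\<in>{1..m}. \<Sum>q | q permutes {1..m}. t ^ num_cycles (Suc m) (Transposition.transpose (Suc m) b \<circ> q) *
         v (g \<circ> (Transposition.transpose (Suc m) b \<circ> q)))"
    unfolding ins by (subst sum_over_permutations_insert) auto
  also have "\<dots> = t * ?w g + (\<Sum>b\<in>{1..m}. ?w (g \<circ> Transposition.transpose (Suc m) b))"
  proof (rule arg_cong2[where f = "(+)", OF _ sum.cong[OF refl]])
    show "(\<Sum>q | q permutes {1..m}. t ^ num_cycles (Suc m) q * v (g \<circ> q)) = t * ?w g"
      unfolding sum_distrib_left
      by (intro sum.cong refl) (simp only: num_cycles_Suc mem_Collect_eq power_Suc mult.assoc)
    fix b assume "b \<in> {1..m}"
    then show "(\<Sum>q | q permutes {1..m}. t ^ num_cycles (Suc m) (Transposition.transpose (Suc m) b \<circ> q) *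
        v (g \<circ> (Transposition.transpose (Suc m) b \<circ> q))) = ?w (g \<circ> Transposition.transpose (Suc m) b)"
      by (intro sum.cong refl)
        (simp only: num_cycles_transpose_comp mem_Collect_eq comp_assoc)
  qed
  also have "\<dots> = (t + a (Suc m)) * ((\<Prod>i\<in>{1..m}. (t + a i)) * v g)"
    unfolding Suc.IH[OF ev] sum_distrib_left[symmetric]
    using J by (simp add: jucys_murphy_def Transposition.transpose_commute atLeastLessThanSuc_atLeastAtMost algebra_simps)
  also have "\<dots> = (\<Prod>i\<in>{1..Suc m}. (t + a i)) * v g" by simp
  finally show ?case .
qed

lemma eulerian_cycle_power_nonneg:
  assumes n: "n \<ge> 1"
  shows "(\<Sum>g | g permutes {1..n}. f g *
    right_conv n (\<lambda>p. eulerian n (\<lambda>x. real x ^ num_cycles n p) k) f g) \<ge> 0"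
proof (rule central_conv_nonneg)
  fix a v c
  assume ev: "joint_eigenvector n n a v"
    and c: "\<And>g. right_conv n (\<lambda>p. eulerian n (\<lambda>x. real x ^ num_cycles n p) k) v g = c * v g"
  obtain g where g: "v g \<noteq> 0" using ev by (auto simp: joint_eigenvector_def)
  \<comment> \<open>By linearity \<open>eulerian\<close> can be applied after the sum over the
    group, where the sum factors through the eigenvalues.\<close>
  have "c * v g = eulerian n (\<lambda>x. \<Sum>p | p permutes {1..n}. real x ^ num_cycles n p * v (g \<circ> p)) k"
    unfolding c[symmetric] right_conv_def eulerian_linear_sum ..
  also have "\<dots> = eulerian n (\<lambda>x. \<Prod>i\<in>{1..n}. (real x + a i)) k * v g"
    unfolding sum_cycle_powers_joint_eigenvector[OF ev]
    by (simp add: eulerian_def sum_distrib_right mult.assoc)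
  finally have "c = eulerian n (\<lambda>x. \<Prod>i\<in>{1..n}. (real x + a i)) k" using g by simp
  moreover have "eulerian_content n a" using joint_eigenvector_content[OF ev] by simp
  ultimately show "c \<ge> 0" using eulerian_content_nonneg[where m = "n - 1" and a = a and k = k] n by simp
qed (simp_all add: num_cycles_conj num_cycles_inv)

subsection \<open>Hook symmetrizers and interpolation\<close>

text \<open>The rising factorial as generating function of the Stirling numbers of the first kind;
  it is the case of the trivial representation, with eigenvalues \<open>i - 1\<close>.\<close>

lemma sum_cycle_powers:
  fixes t :: "'a::comm_ring_1"
  shows "(\<Sum>p | p permutes {1..m}. t ^ num_cycles m p) = (\<Prod>i\<in>{1..m}. (t + of_nat (i - 1)))"
proof (induction m)
  case 0
  show ?case by (simp add: num_cycles_def)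
next
  case (Suc m)
  have ins: "{1..Suc m} = insert (Suc m) {1..m}" by auto
  let ?S = "\<Sum>p | p permutes {1..m}. t ^ num_cycles m p"
  have "(\<Sum>p | p permutes {1..Suc m}. t ^ num_cycles (Suc m) p) =
     (\<Sum>q | q permutes {1..m}. t ^ num_cycles (Suc m) q) +
     (\<Sum>b\<in>{1..m}. \<Sum>q | q permutes {1..m}. t ^ num_cycles (Suc m) (Transposition.transpose (Suc m) b \<circ> q))"
    unfolding ins by (subst sum_over_permutations_insert) auto
  also have "\<dots> = t * ?S + (\<Sum>b\<in>{1..m}. ?S)"
  proof (rule arg_cong2[where f = "(+)", OF _ sum.cong[OF refl]])
    show "(\<Sum>q | q permutes {1..m}. t ^ num_cycles (Suc m) q) = t * ?S"
      unfolding sum_distrib_left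
      by (intro sum.cong refl) (simp only: num_cycles_Suc mem_Collect_eq power_Suc)
    fix b assume "b \<in> {1..m}"
    then show "(\<Sum>q | q permutes {1..m}. t ^ num_cycles (Suc m) (Transposition.transpose (Suc m) b \<circ> q)) = ?S"
      by (intro sum.cong refl) (simp only: num_cycles_transpose_comp mem_Collect_eq)
  qed
  also have "\<dots> = (t + of_nat m) * ?S" by (simp add: algebra_simps)
  finally show ?case unfolding Suc.IH by (simp add: mult.commute)
qed

text \<open>Contents of the hook whose arm has \<open>a\<close> boxes, read along the arm from 0 to
  \<open>a - 1\<close> and then down the leg from -1.\<close>

definition hook_content :: "nat \<Rightarrow> nat \<Rightarrow> int" where
  "hook_content a i = (if i \<le> a then int i - 1 else int a - int i)"

text \<open>Induction on the leg. A new leg point is either fixed, with factor \<open>t\<close>, or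
  attached by one of the \<open>m + 1 - a\<close> transpositions with a point of
  \<open>{a..m}\<close>, each reversing the sign; the new factor is
  \<open>t - (m + 1 - a)\<close>.\<close>

lemma sum_hook_cycle_powers:
  fixes t :: "'a::comm_ring_1"
  assumes "1 \<le> a" "a \<le> m"
  shows "(\<Sum>c | c permutes {a..m}. \<Sum>r | r permutes {1..a}. of_int (sign c) * t ^ num_cycles m (c \<circ> r)) =
    (\<Prod>i\<in>{1..m}. (t + of_int (hook_content a i)))"
  using assms(2)
proof (induction m rule: dec_induct)
  case base
  have "(\<Prod>i\<in>{1..a}. (t + of_nat (i - 1))) = (\<Prod>i\<in>{1..a}. (t + of_int (hook_content a i)))"
    by (rule prod.cong) (auto simp: hook_content_def)
  moreover have "{c. c permutes {a..a}} = {id}" by auto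
  ultimately show ?case using sum_cycle_powers[of t a] by simp
next
  case (step m)
  have ins: "{a..Suc m} = insert (Suc m) {a..m}" using step(1) by auto
  let ?R = "{r. r permutes {1..a}}" and ?C = "{c. c permutes {a..m}}"
  let ?S = "\<Sum>c\<in>?C. \<Sum>r\<in>?R. of_int (sign c) * t ^ num_cycles m (c \<circ> r)"
  have cr: "c \<circ> r permutes {1..m}" if "c \<in> ?C" "r \<in> ?R" for c r
  proof -
    have "c permutes {1..m}" using that(1) assms(1) by (auto intro: permutes_subset)
    moreover have "r permutes {1..m}" using that(2) step(1) by (auto intro: permutes_subset)
    ultimately show ?thesis by (rule permutes_compose[rotated])
  qed
  have "(\<Sum>c | c permutes {a..Suc m}. \<Sum>r\<in>?R. of_int (sign c) * t ^ num_cycles (Suc m) (c \<circ> r)) =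
     (\<Sum>c\<in>?C. \<Sum>r\<in>?R. of_int (sign c) * t ^ num_cycles (Suc m) (c \<circ> r)) +
     (\<Sum>b\<in>{a..m}. \<Sum>c\<in>?C. \<Sum>r\<in>?R. of_int (sign (Transposition.transpose (Suc m) b \<circ> c)) *
        t ^ num_cycles (Suc m) (Transposition.transpose (Suc m) b \<circ> c \<circ> r))"
    unfolding ins by (subst sum_over_permutations_insert) auto
  also have "\<dots> = t * ?S + (\<Sum>b\<in>{a..m}. - ?S)"
  proof (rule arg_cong2[where f = "(+)", OF _ sum.cong[OF refl]])
    show "(\<Sum>c\<in>?C. \<Sum>r\<in>?R. of_int (sign c) * t ^ num_cycles (Suc m) (c \<circ> r)) = t * ?S"
      unfolding sum_distrib_left
      by (intro sum.cong refl) (simp only: num_cycles_Suc[OF cr] power_Suc mult.left_commute)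
    fix b assume b: "b \<in> {a..m}"
    have b': "b \<in> {1..m}" using b assms(1) by auto
    have "of_int (sign (Transposition.transpose (Suc m) b \<circ> c)) = (- of_int (sign c) :: 'a)" if "c \<in> ?C" for c
    proof -
      have "permutation c" using that by (auto simp: permutation_permutes)
      then show ?thesis using b
        by (subst sign_compose) (auto simp: permutation_swap_id sign_swap_id)
    qed
    then show "(\<Sum>c\<in>?C. \<Sum>r\<in>?R. of_int (sign (Transposition.transpose (Suc m) b \<circ> c)) *
        t ^ num_cycles (Suc m) (Transposition.transpose (Suc m) b \<circ> c \<circ> r)) = - ?S"
      unfolding sum_negf[symmetric]
      by (intro sum.cong refl) (simp only: num_cycles_transpose_comp[OF cr b'] comp_assoc mult_minus_left)
  qed
  also have "\<dots> = (t + of_int (hook_content a (Suc m))) * ?S"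
    using step(1) by (simp add: hook_content_def algebra_simps of_nat_diff)
  also have "\<dots> = (\<Prod>i\<in>{1..Suc m}. (t + of_int (hook_content a i)))"
    unfolding step.IH by (simp add: mult.commute)
  finally show ?case .
qed

text \<open>A single nonzero entry survives the recurrence. An arm box multiplies the entry at 1 by
  the new length, and its transfer to 2 has coefficient 0. A leg box has coefficient 0 at the old
  position and moves the entry up by one with factor \<open>Suc m\<close>.\<close>

lemma eulerian_hook:
  assumes "1 \<le> a" "a \<le> m"
  shows "eulerian m (\<lambda>x. \<Prod>i\<in>{1..m}. (of_nat x + of_int (hook_content a i))) k =
    (if k = m - a + 1 then fact m else (0 :: 'a::{comm_ring_1,ring_char_0}))"
  using assms(2)
proof (induction m arbitrary: k rule: dec_induct)
  case base
  \<comment> \<open>The arm is built by an induction of its own; the outer one adds only leg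
    boxes.\<close>
  have "eulerian l (\<lambda>x. \<Prod>i\<in>{1..l}. (of_nat x + of_int (hook_content a i))) k =
    (if k = 1 then fact l else (0 :: 'a))" if "l \<le> a" for l k
    using that
  proof (induction l arbitrary: k)
    case 0
    then show ?case by (simp add: eulerian_constant)
  next
    case (Suc l)
    then have IH: "eulerian l (\<lambda>x. \<Prod>i\<in>{1..l}. (of_nat x + of_int (hook_content a i))) k =
      (if k = 1 then fact l else (0 :: 'a))" for k by simp
    show ?case
    proof (cases k)
      case (Suc k')
      have "of_int (hook_content a (Suc l)) = (of_nat l :: 'a)" using \<open>Suc l \<le> a\<close> by (simp add: hook_content_def)
      then show ?thesis unfolding Suc eulerian_prod_Suc IH by (auto simp: algebra_simps)
    qed simp
  qed
  from this[of a] show ?case by simp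
next
  case (step m)
  show ?case
  proof (cases k)
    case (Suc k')
    have *: "of_int (hook_content a (Suc m)) = of_nat a - (of_nat (Suc m) :: 'a)"
      using step(1) by (simp add: hook_content_def)
    obtain d where d: "m = a + d" using step(1) le_Suc_ex by blast
    show ?thesis unfolding Suc eulerian_prod_Suc step.IH * unfolding d
      by (auto simp: algebra_simps)
  qed simp
qed

section \<open>Interpolation by powers and inversion of the alternating sums\<close>

text \<open>
  The combination \<open>f (l + 1) - (n + 1) * f l\<close> annihilates the term \<open>(n + 1) ^ l\<close> and thus reduces the
  interpolation problem to one with fewer powers and fewer points.
\<close>

lemma power_sums_interpolation:
  fixes f :: "nat \<Rightarrow> 'a::field_char_0"
  shows "\<exists>c. \<forall>l\<in>{1..n}. f l = (\<Sum>k\<in>{1..n}. c k * of_nat k ^ l)"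
proof (induction n arbitrary: f)
  case 0
  then show ?case by simp
next
  case (Suc n)
  obtain d where d: "\<forall>l\<in>{1..n}. f (Suc l) - of_nat (Suc n) * f l = (\<Sum>k\<in>{1..n}. d k * of_nat k ^ l)"
    using Suc.IH[of "\<lambda>l. f (Suc l) - of_nat (Suc n) * f l"] by blast
  \<comment> \<open>Undoes the factor \<open>k - (n + 1)\<close> that the combination puts on the
    term \<open>k ^ l\<close>.\<close>
  define c where "c k = d k / (of_nat k - of_nat (Suc n))" for k
  define e where "e l = f l - (\<Sum>k\<in>{1..n}. c k * of_nat k ^ l)" for l
  have c: "d k = c k * of_nat k - of_nat (Suc n) * c k" if "k \<in> {1..n}" for k
  proof -
    have "of_nat k - of_nat (Suc n) \<noteq> (0::'a)" using that by (metis Suc_n_not_le_n atLeastAtMost_iff eq_iff_diff_eq_0 of_nat_eq_iff)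
    then show ?thesis by (simp add: c_def divide_simps) (simp add: algebra_simps)
  qed
  \<comment> \<open>The remainder is a geometric progression of ratio \<open>Suc n\<close>, so the
    one new node \<open>Suc n\<close> absorbs it, with a weight determined by
    \<open>e 1\<close>.\<close>
  have e: "e (Suc l) = of_nat (Suc n) * e l" if "l \<in> {1..n}" for l
  proof -
    have "(\<Sum>k\<in>{1..n}. d k * of_nat k ^ l) =
      (\<Sum>k\<in>{1..n}. c k * of_nat k ^ Suc l - of_nat (Suc n) * (c k * of_nat k ^ l))"
      by (rule sum.cong) (simp_all add: c algebra_simps)
    then show ?thesis using d that
      by (simp add: e_def sum_subtractf sum_distrib_left right_diff_distrib del: of_nat_Suc) (simp add: algebra_simps)
  qed
  have e': "e (Suc l) = of_nat (Suc n) ^ l * e 1" if "l \<le> n" for l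
    using that by (induction l) (simp_all add: e del: of_nat_Suc)
  have "f l = (\<Sum>k\<in>{1..Suc n}. (c(Suc n := e 1 / of_nat (Suc n))) k * of_nat k ^ l)" if l: "l \<in> {1..Suc n}" for l
  proof -
    obtain l' where l': "l = Suc l'" "l' \<le> n" using l by (cases l) auto
    have "(\<Sum>k\<in>{1..n}. (c(Suc n := e 1 / of_nat (Suc n))) k * of_nat k ^ l) = (\<Sum>k\<in>{1..n}. c k * of_nat k ^ l)"
      by (rule sum.cong) auto
    then have "(\<Sum>k\<in>{1..Suc n}. (c(Suc n := e 1 / of_nat (Suc n))) k * of_nat k ^ l) =
      (\<Sum>k\<in>{1..n}. c k * of_nat k ^ l) + e 1 / of_nat (Suc n) * of_nat (Suc n) ^ l"
      by (simp del: of_nat_Suc)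
    also have "e 1 / of_nat (Suc n) * of_nat (Suc n) ^ l = e l"
      using e'[OF l'(2)] l'(1) by (simp add: field_simps del: of_nat_Suc)
    finally show ?thesis by (simp add: e_def)
  qed
  then show ?case by (intro exI ballI)
qed

text \<open>\<open>eulerian n p k\<close> is \<open>p k\<close> plus a combination of values of
  \<open>p\<close> at smaller arguments, and this triangular system is inverted. The order of the
  quantifiers matters: the coefficients do not depend on \<open>p\<close>.\<close>

lemma value_eq_sum_eulerian:
  assumes "k \<ge> 1"
  shows "\<exists>d. \<forall>p :: nat \<Rightarrow> 'a::comm_ring_1. p k = (\<Sum>i\<in>{1..k}. d i * eulerian n p i)"
  using assms
proof (induction k rule: less_induct)
  case (less k)
  have "\<forall>j\<in>{1..<k}. \<exists>d. \<forall>p :: nat \<Rightarrow> 'a. p (k - j) = (\<Sum>i\<in>{1..k - j}. d i * eulerian n p i)"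
    using less.IH by auto
  from bchoice[OF this]
  obtain d where "\<forall>j\<in>{1..<k}. \<forall>p :: nat \<Rightarrow> 'a. p (k - j) = (\<Sum>i\<in>{1..k - j}. d j i * eulerian n p i)" ..
  then have d: "p (k - j) = (\<Sum>i\<in>{1..k - j}. d j i * eulerian n p i)" if "j \<in> {1..<k}" for j p
    using that by (elim ballE allE) auto
  \<comment> \<open>Padding with zeros gives all sums the common range \<open>{1..k}\<close>, so
    that they can be interchanged.\<close>
  define u where "u j i = (if i \<le> k - j then d j i else 0)" for j i
  have u: "p (k - j) = (\<Sum>i\<in>{1..k}. u j i * eulerian n p i)" if "j \<in> {1..<k}" for j p
  proof -
    have "(\<Sum>i\<in>{1..k}. u j i * eulerian n p i) = (\<Sum>i\<in>{1..k - j}. d j i * eulerian n p i)"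
      by (rule sum.mono_neutral_cong_right) (auto simp: u_def)
    then show ?thesis using d[OF that] by simp
  qed
  define b where "b j = (-1) ^ j * (of_nat (n + 1 choose j) :: 'a)" for j
  define e where "e i = (if i = k then 1 else 0) - (\<Sum>j\<in>{1..<k}. b j * u j i)" for i
  have "p k = (\<Sum>i\<in>{1..k}. e i * eulerian n p i)" for p :: "nat \<Rightarrow> 'a"
  proof -
    have "{..<k} = insert 0 {1..<k}" using less.prems by auto
    then have "eulerian n p k = p k + (\<Sum>j\<in>{1..<k}. b j * p (k - j))"
      by (simp add: eulerian_def b_def)
    also have "(\<Sum>j\<in>{1..<k}. b j * p (k - j)) = (\<Sum>j\<in>{1..<k}. \<Sum>i\<in>{1..k}. b j * u j i * eulerian n p i)"
      by (rule sum.cong) (simp_all add: u sum_distrib_left mult.assoc del: One_nat_def)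
    also have "\<dots> = (\<Sum>i\<in>{1..k}. (\<Sum>j\<in>{1..<k}. b j * u j i) * eulerian n p i)"
      by (subst sum.swap) (simp add: sum_distrib_right)
    finally have "p k = eulerian n p k - (\<Sum>i\<in>{1..k}. (\<Sum>j\<in>{1..<k}. b j * u j i) * eulerian n p i)"
      by simp
    moreover have "eulerian n p k = (\<Sum>i\<in>{1..k}. (if i = k then 1 else 0) * eulerian n p i)"
    proof -
      have "(\<Sum>i\<in>{1..k}. (if i = k then 1 else 0) * eulerian n p i) = (\<Sum>i\<in>{1..k}. if k = i then eulerian n p i else 0)"
        by (rule sum.cong) auto
      then show ?thesis using less.prems by (simp add: sum.delta)
    qed
    ultimately show ?thesis by (simp add: e_def left_diff_distrib sum_subtractf)
  qed
  then show ?case by (intro exI allI)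
qed

text \<open>Every function of the number of cycles \<open>l\<close> is a combination of the powers
  \<open>k ^ l\<close>; the triangular inversion, with coefficients independent of \<open>l\<close>,
  rewrites these in terms of the tau_k.\<close>

lemma eulerian_span:
  fixes f :: "nat \<Rightarrow> 'a::field_char_0"
  shows "\<exists>c. \<forall>l\<in>{1..n}. f l = (\<Sum>k\<in>{1..n}. c k * eulerian n (\<lambda>x. of_nat x ^ l) k)"
proof -
  obtain a where a: "\<forall>l\<in>{1..n}. f l = (\<Sum>k\<in>{1..n}. a k * of_nat k ^ l)"
    using power_sums_interpolation by blast
  have "\<forall>k\<in>{1..n}. \<exists>d. \<forall>p :: nat \<Rightarrow> 'a. p k = (\<Sum>i\<in>{1..k}. d i * eulerian n p i)"
    using value_eq_sum_eulerian by auto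
  from bchoice[OF this]
  obtain d where "\<forall>k\<in>{1..n}. \<forall>p :: nat \<Rightarrow> 'a. p k = (\<Sum>i\<in>{1..k}. d k i * eulerian n p i)" ..
  then have d: "p k = (\<Sum>i\<in>{1..k}. d k i * eulerian n p i)" if "k \<in> {1..n}" for k p
    using that by (elim ballE allE) auto
  define u where "u k i = (if i \<le> k then d k i else 0)" for k i
  have u: "p k = (\<Sum>i\<in>{1..n}. u k i * eulerian n p i)" if "k \<in> {1..n}" for k p
  proof -
    have "(\<Sum>i\<in>{1..n}. u k i * eulerian n p i) = (\<Sum>i\<in>{1..k}. d k i * eulerian n p i)"
      by (rule sum.mono_neutral_cong_right) (use that in \<open>auto simp: u_def\<close>)
    then show ?thesis using d[OF that] by simp
  qed
  have "f l = (\<Sum>i\<in>{1..n}. (\<Sum>k\<in>{1..n}. a k * u k i) * eulerian n (\<lambda>x. of_nat x ^ l) i)" if "l \<in> {1..n}" for l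
  proof -
    have "f l = (\<Sum>k\<in>{1..n}. a k * of_nat k ^ l)" using a that by blast
    also have "\<dots> = (\<Sum>k\<in>{1..n}. a k * (\<Sum>i\<in>{1..n}. u k i * eulerian n (\<lambda>x. of_nat x ^ l) i))"
      by (intro sum.cong refl arg_cong2[where f = "(*)"] u[where p = "\<lambda>x. of_nat x ^ l"])
    also have "\<dots> = (\<Sum>i\<in>{1..n}. (\<Sum>k\<in>{1..n}. a k * u k i) * eulerian n (\<lambda>x. of_nat x ^ l) i)"
      unfolding sum_distrib_left sum_distrib_right by (subst sum.swap) (simp add: mult.assoc)
    finally show ?thesis .
  qed
  then show ?thesis by (intro exI ballI)
qed

subsection \<open>Block characters\<close>

lemma positive_definite_fun_sym_group_iff:
  "positive_definite_fun (sym_group n) \<phi> \<longleftrightarrow>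
    (\<forall>m g. (\<forall>i<m. g i permutes {1..n}) \<longrightarrow>
      hermitian m (\<lambda>i j. \<phi> (g i \<circ> inv' (g j))) \<and> nonneg_definite m (\<lambda>i j. \<phi> (g i \<circ> inv' (g j))))"
proof -
  have "hermitian m (\<lambda>i j. \<phi> (g i \<otimes>\<^bsub>sym_group n\<^esub> inv\<^bsub>sym_group n\<^esub> (g j))) \<longleftrightarrow>
      hermitian m (\<lambda>i j. \<phi> (g i \<circ> inv' (g j)))"
    "nonneg_definite m (\<lambda>i j. \<phi> (g i \<otimes>\<^bsub>sym_group n\<^esub> inv\<^bsub>sym_group n\<^esub> (g j))) \<longleftrightarrow>
      nonneg_definite m (\<lambda>i j. \<phi> (g i \<circ> inv' (g j)))"
    if g: "\<forall>i<m. g i \<in> carrier (sym_group n)" for m g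
  proof -
    have e: "g i \<otimes>\<^bsub>sym_group n\<^esub> inv\<^bsub>sym_group n\<^esub> (g j) = g i \<circ> inv' (g j)" if "j < m" for i j
      using g that by (simp add: sym_group_mult)
    show "hermitian m (\<lambda>i j. \<phi> (g i \<otimes>\<^bsub>sym_group n\<^esub> inv\<^bsub>sym_group n\<^esub> (g j))) \<longleftrightarrow>
      hermitian m (\<lambda>i j. \<phi> (g i \<circ> inv' (g j)))"
      by (simp add: hermitian_def e)
    show "nonneg_definite m (\<lambda>i j. \<phi> (g i \<otimes>\<^bsub>sym_group n\<^esub> inv\<^bsub>sym_group n\<^esub> (g j))) \<longleftrightarrow>
      nonneg_definite m (\<lambda>i j. \<phi> (g i \<circ> inv' (g j)))"
    proof -
      have "(\<Sum>i<m. \<Sum>j<m. cnj (x i) * \<phi> (g i \<otimes>\<^bsub>sym_group n\<^esub> inv\<^bsub>sym_group n\<^esub> (g j)) * x j) =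
          (\<Sum>i<m. \<Sum>j<m. cnj (x i) * \<phi> (g i \<circ> inv' (g j)) * x j)" for x
        by (intro sum.cong refl) (simp only: e lessThan_iff)
      then show ?thesis by (simp only: nonneg_definite_def)
    qed
  qed
  then show ?thesis
    unfolding positive_definite_fun_def by (simp add: sym_group_carrier)
qed

text \<open>Passes from the quadratic form on the whole group to finite families of elements,
  possibly with repetitions.\<close>

lemma class_function_kernel_form_nonneg:
  fixes w :: "(nat \<Rightarrow> nat) \<Rightarrow> real" and y :: "nat \<Rightarrow> real"
  assumes conj: "\<And>p q. p permutes {1..n} \<Longrightarrow> q permutes {1..n} \<Longrightarrow> w (q \<circ> p \<circ> inv' q) = w p"
    and inv: "\<And>p. p permutes {1..n} \<Longrightarrow> w (inv' p) = w p"
    and nonneg: "\<And>f. (\<Sum>g | g permutes {1..n}. f g * right_conv n w f g) \<ge> 0"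
    and g: "\<And>i. i < m \<Longrightarrow> g i permutes {1..n}"
  shows "(\<Sum>i<m. \<Sum>j<m. y i * w (g i \<circ> inv' (g j)) * y j) \<ge> 0"
proof -
  let ?P = "{p. p permutes {1..n}}"
  have fin: "finite ?P" by (simp add: finite_permutations)
  \<comment> \<open>Weights of indices with the same group element are added up.\<close>
  define F where "F h = (\<Sum>j<m. if g j = h then y j else 0)" for h
  \<comment> \<open>Convolution has the kernel \<open>inv' h \<circ> g j\<close>, positive
    definiteness the kernel \<open>h \<circ> inv' (g j)\<close>; one is conjugate to the inverse of
    the other.\<close>
  have kernel: "w (inv' h \<circ> g j) = w (h \<circ> inv' (g j))" if h: "h \<in> ?P" and j: "j < m" for h j
  proof -
    have h': "h permutes {1..n}" using h by simp
    have p: "inv' h \<circ> g j permutes {1..n}" by (intro permutes_compose permutes_inv g j h')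
    have "w (h \<circ> inv' (g j)) = w (inv' (h \<circ> inv' (g j)))"
      using inv[of "h \<circ> inv' (g j)"] permutes_compose[OF permutes_inv[OF g[OF j]] h'] by simp
    also have "inv' (h \<circ> inv' (g j)) = g j \<circ> inv' h"
      by (simp add: o_inv_distrib permutes_bij[OF h'] permutes_bij[OF permutes_inv[OF g[OF j]]]
          permutes_inv_inv[OF g[OF j]])
    also have "g j \<circ> inv' h = h \<circ> (inv' h \<circ> g j) \<circ> inv' h"
      by (simp add: permutes_inv_o[OF h'] flip: comp_assoc)
    also have "w \<dots> = w (inv' h \<circ> g j)" by (rule conj[OF p h'])
    finally show ?thesis by (rule sym)
  qed
  have conv: "right_conv n w F h = (\<Sum>j<m. w (h \<circ> inv' (g j)) * y j)" if h: "h \<in> ?P" for h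
  proof -
    have h': "h permutes {1..n}" using h by simp
    have "right_conv n w F h = (\<Sum>j<m. \<Sum>p\<in>?P. if g j = h \<circ> p then w p * y j else 0)"
      unfolding right_conv_def F_def sum_distrib_left
      by (subst sum.swap) (intro sum.cong refl, simp)
    also have "\<dots> = (\<Sum>j<m. w (inv' h \<circ> g j) * y j)"
    proof (intro sum.cong refl)
      fix j assume "j \<in> {..<m}"
      then have j: "j < m" by simp
      have eq: "g j = h \<circ> p \<longleftrightarrow> p = inv' h \<circ> g j" for p
        by (metis comp_assoc h' id_comp permutes_inv_o)
      have "inv' h \<circ> g j \<in> ?P" using permutes_compose[OF g[OF j] permutes_inv[OF h']] by simp
      then show "(\<Sum>p\<in>?P. if g j = h \<circ> p then w p * y j else 0) = w (inv' h \<circ> g j) * y j"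
        unfolding eq using fin by (simp add: sum.delta)
    qed
    also have "\<dots> = (\<Sum>j<m. w (h \<circ> inv' (g j)) * y j)"
      by (intro sum.cong refl) (simp only: kernel[OF h] lessThan_iff)
    finally show ?thesis .
  qed
  have "(\<Sum>h\<in>?P. F h * right_conv n w F h) = (\<Sum>i<m. \<Sum>h\<in>?P. if g i = h then y i * right_conv n w F h else 0)"
    unfolding F_def sum_distrib_right by (subst sum.swap) (intro sum.cong refl, simp)
  also have "\<dots> = (\<Sum>i<m. y i * right_conv n w F (g i))"
    using fin g by (intro sum.cong refl) (simp add: sum.delta')
  also have "\<dots> = (\<Sum>i<m. \<Sum>j<m. y i * w (g i \<circ> inv' (g j)) * y j)"
    by (intro sum.cong refl) (use g in \<open>simp add: conv sum_distrib_left mult.assoc del: One_nat_def\<close>)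
  finally show ?thesis using nonneg[of F] by simp
qed

text \<open>A complex vector is split into real and imaginary parts: symmetry of the kernel cancels
  the imaginary part of the form, and the real part is a sum of two real forms.\<close>

lemma positive_definite_fun_of_real_class_function:
  fixes w :: "(nat \<Rightarrow> nat) \<Rightarrow> real"
  assumes conj: "\<And>p q. p permutes {1..n} \<Longrightarrow> q permutes {1..n} \<Longrightarrow> w (q \<circ> p \<circ> inv' q) = w p"
    and inv: "\<And>p. p permutes {1..n} \<Longrightarrow> w (inv' p) = w p"
    and nonneg: "\<And>f. (\<Sum>g | g permutes {1..n}. f g * right_conv n w f g) \<ge> 0"
    and \<phi>: "\<And>p. p permutes {1..n} \<Longrightarrow> \<phi> p = of_real (w p)"
  shows "positive_definite_fun (sym_group n) \<phi>"
  unfolding positive_definite_fun_sym_group_iff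
proof (intro allI impI conjI)
  fix m and g :: "nat \<Rightarrow> nat \<Rightarrow> nat"
  assume "\<forall>i<m. g i permutes {1..n}"
  then have g: "i < m \<Longrightarrow> g i permutes {1..n}" for i by simp
  have gg: "g i \<circ> inv' (g j) permutes {1..n}" if "i < m" "j < m" for i j
    by (intro permutes_compose permutes_inv g that)
  have sym: "w (g i \<circ> inv' (g j)) = w (g j \<circ> inv' (g i))" if "i < m" "j < m" for i j
  proof -
    have "inv' (g i \<circ> inv' (g j)) = g j \<circ> inv' (g i)"
      by (simp add: o_inv_distrib permutes_bij[OF g[OF that(1)]] permutes_bij[OF permutes_inv[OF g[OF that(2)]]]
          permutes_inv_inv[OF g[OF that(2)]])
    then show ?thesis using inv[OF gg[OF that]] by simp
  qed
  show "hermitian m (\<lambda>i j. \<phi> (g i \<circ> inv' (g j)))"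
    unfolding hermitian_def using \<phi> gg sym by simp
  show "nonneg_definite m (\<lambda>i j. \<phi> (g i \<circ> inv' (g j)))"
    unfolding nonneg_definite_def
  proof
    fix x :: "nat \<Rightarrow> complex"
    define W where "W i j = w (g i \<circ> inv' (g j))" for i j
    have "(\<Sum>i<m. \<Sum>j<m. cnj (x i) * \<phi> (g i \<circ> inv' (g j)) * x j) = (\<Sum>i<m. \<Sum>j<m. cnj (x i) * of_real (W i j) * x j)"
      by (intro sum.cong refl) (simp add: \<phi> gg W_def del: One_nat_def)
    moreover have "Re (\<Sum>i<m. \<Sum>j<m. cnj (x i) * of_real (W i j) * x j) =
      (\<Sum>i<m. \<Sum>j<m. Re (x i) * W i j * Re (x j)) + (\<Sum>i<m. \<Sum>j<m. Im (x i) * W i j * Im (x j))"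
      by (simp add: sum.distrib[symmetric] algebra_simps)
    moreover have "Im (\<Sum>i<m. \<Sum>j<m. cnj (x i) * of_real (W i j) * x j) =
      (\<Sum>i<m. \<Sum>j<m. Re (x i) * W i j * Im (x j)) - (\<Sum>i<m. \<Sum>j<m. Im (x i) * W i j * Re (x j))"
      by (simp add: sum_subtractf[symmetric] algebra_simps)
    moreover have "(\<Sum>i<m. \<Sum>j<m. Im (x i) * W i j * Re (x j)) = (\<Sum>i<m. \<Sum>j<m. Re (x i) * W i j * Im (x j))"
      by (subst sum.swap) (intro sum.cong refl, simp add: W_def sym)
    moreover have "(\<Sum>i<m. \<Sum>j<m. y i * W i j * y j) \<ge> 0" for y
      unfolding W_def by (rule class_function_kernel_form_nonneg[OF conj inv nonneg g])
    ultimately show "(\<Sum>i<m. \<Sum>j<m. cnj (x i) * \<phi> (g i \<circ> inv' (g j)) * x j) \<in> \<real>\<^sub>\<ge>\<^sub>0"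
      by (simp add: complex_nonneg_Reals_iff)
  qed
qed

lemma block_tau_eq_eulerian:
  assumes "g permutes {1..n}"
  shows "block_tau n k g = eulerian n (\<lambda>x. of_nat x ^ num_cycles n g) k"
  using assms by (simp add: block_tau_def block_sigma_def eulerian_def sym_group_carrier)

lemma of_real_eulerian: "of_real (eulerian m p k) = eulerian m (\<lambda>x. of_real (p x)) k"
  by (simp add: eulerian_def)

lemma positive_definite_block_tau:
  assumes "n \<ge> 1"
  shows "positive_definite_fun (sym_group n) (block_tau n k)"
proof (rule positive_definite_fun_of_real_class_function)
  show "block_tau n k p = of_real (eulerian n (\<lambda>x. real x ^ num_cycles n p) k)" if "p permutes {1..n}" for p
    by (simp add: block_tau_eq_eulerian[OF that] of_real_eulerian)
qed (simp_all add: num_cycles_conj num_cycles_inv eulerian_cycle_power_nonneg assms del: One_nat_def)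

section \<open>Hook functionals on block characters\<close>

text \<open>Any finite index set is allowed, since the hook argument is indexed by pairs of an arm
  and a leg permutation.\<close>

lemma positive_definite_fun_finite_form:
  assumes "positive_definite_fun (sym_group n) \<phi>" "finite I" "\<And>i. i \<in> I \<Longrightarrow> g i permutes {1..n}"
  shows "(\<Sum>i\<in>I. \<Sum>j\<in>I. cnj (x i) * \<phi> (g i \<circ> inv' (g j)) * x j) \<in> \<real>\<^sub>\<ge>\<^sub>0"
proof -
  obtain h where h: "bij_betw h {..<card I} I"
    using ex_bij_betw_nat_finite[OF assms(2)] by (auto simp: atLeast0LessThan)
  have "h i \<in> I" if "i < card I" for i using h that by (auto simp: bij_betw_def)
  then have "nonneg_definite (card I) (\<lambda>i j. \<phi> (g (h i) \<circ> inv' (g (h j))))"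
    using assms(1)[unfolded positive_definite_fun_sym_group_iff, rule_format, of "card I" "g \<circ> h"] assms(3)
    by simp
  then have "(\<Sum>i<card I. \<Sum>j<card I. cnj (x (h i)) * \<phi> (g (h i) \<circ> inv' (g (h j))) * x (h j)) \<in> \<real>\<^sub>\<ge>\<^sub>0"
    unfolding nonneg_definite_def by (elim allE[of _ "x \<circ> h"]) simp
  also have "(\<Sum>i<card I. \<Sum>j<card I. cnj (x (h i)) * \<phi> (g (h i) \<circ> inv' (g (h j))) * x (h j)) =
     (\<Sum>i\<in>I. \<Sum>j\<in>I. cnj (x i) * \<phi> (g i \<circ> inv' (g j)) * x j)"
    by (simp add: sum.reindex_bij_betw[OF h, of "\<lambda>j. cnj (x _) * \<phi> (g _ \<circ> inv' (g j)) * x j"]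
        sum.reindex_bij_betw[OF h, of "\<lambda>i. \<Sum>j\<in>I. cnj (x i) * \<phi> (g i \<circ> inv' (g j)) * x j"])
  finally show ?thesis .
qed

text \<open>
  Up to a scalar, \<open>hook_functional n a \<phi>\<close> is \<open>\<phi>\<close> evaluated at the Young symmetrizer of the hook
  with arm \<open>{1..a}\<close> and leg \<open>{a..n}\<close>.
\<close>

definition hook_functional :: "nat \<Rightarrow> nat \<Rightarrow> ((nat \<Rightarrow> nat) \<Rightarrow> complex) \<Rightarrow> complex" where
  "hook_functional n a \<phi> = (\<Sum>c | c permutes {a..n}. \<Sum>r | r permutes {1..a}. of_int (sign c) * \<phi> (c \<circ> r))"

lemma hook_permutes:
  fixes a n :: nat
  assumes "1 \<le> a" "a \<le> n" "c permutes {a..n}" "r permutes {1..a}"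
  shows "c \<circ> r permutes {1..n}" "r \<circ> c permutes {1..n}"
proof -
  have "c permutes {1..n}" by (rule permutes_subset[OF assms(3)]) (use assms in auto)
  moreover have "r permutes {1..n}" by (rule permutes_subset[OF assms(4)]) (use assms in auto)
  ultimately show "c \<circ> r permutes {1..n}" "r \<circ> c permutes {1..n}" by (auto intro: permutes_compose)
qed

text \<open>Positive definiteness is applied to the products \<open>r \<circ> c\<close> with weights
  \<open>sign c\<close>. As \<open>\<phi>\<close> does not change when two factors are exchanged,
  \<open>inv' r'\<close> moves to the front and \<open>c \<circ> inv' c'\<close> stands at the end.
  Reindexing turns each inner sum into the functional itself, so the form is a positive multiple of
  it.\<close>

lemma hook_functional_nonneg:
  assumes a: "1 \<le> a" "a \<le> n" and \<phi>: "block_character n \<phi>"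
  shows "hook_functional n a \<phi> \<in> \<real>\<^sub>\<ge>\<^sub>0"
proof -
  let ?R = "{r. r permutes {1..a}}" and ?C = "{c. c permutes {a..n}}"
  obtain f where f: "\<And>g. g permutes {1..n} \<Longrightarrow> \<phi> g = f (num_cycles n g)"
    using \<phi> by (auto simp: block_character_def block_function_def sym_group_carrier)
  have comm: "\<phi> (p \<circ> q) = \<phi> (q \<circ> p)" if "p permutes {1..n}" "q permutes {1..n}" for p q
    using f num_cycles_comp_commute[OF that] that by (simp add: permutes_compose del: One_nat_def)
  have rn: "r permutes {1..n}" if "r \<in> ?R" for r using that a by (auto intro: permutes_subset)
  have cn: "c permutes {1..n}" if "c \<in> ?C" for c using that a by (auto intro: permutes_subset)
  have pc: "permutation c" if "c \<in> ?C" for c using that by (auto simp: permutation_permutes)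
  have fin: "finite ?R" "finite ?C" by (simp_all add: finite_permutations)
  define L where "L = (\<Sum>r\<in>?R. \<Sum>c\<in>?C. of_int (sign c) * \<phi> (r \<circ> c))"
  have "hook_functional n a \<phi> = L"
    unfolding hook_functional_def L_def
    by (subst sum.swap) (intro sum.cong refl, simp only: comm[OF rn cn])
  let ?T = "\<lambda>r c r' c'. of_int (sign c) * \<phi> (r \<circ> c \<circ> inv' (r' \<circ> c')) * of_int (sign c')"
  have inner: "(\<Sum>r\<in>?R. \<Sum>c\<in>?C. ?T r c r' c') = L" if r': "r' \<in> ?R" and c': "c' \<in> ?C" for r' c'
  proof -
    have ir: "inv' r' permutes {1..a}" and ic: "inv' c' permutes {a..n}"
      using r' c' by (simp_all add: permutes_inv del: One_nat_def)
    have "?T r c r' c' = of_int (sign (c \<circ> inv' c')) * \<phi> (inv' r' \<circ> r \<circ> (c \<circ> inv' c'))"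
      if r: "r \<in> ?R" and c: "c \<in> ?C" for r c
    proof -
      have i: "inv' r' permutes {1..n}" "inv' c' permutes {1..n}"
        by (intro permutes_inv rn cn r' c')+
      have "\<phi> (r \<circ> c \<circ> inv' (r' \<circ> c')) = \<phi> ((r \<circ> c \<circ> inv' c') \<circ> inv' r')"
        by (simp add: o_inv_distrib permutes_bij[OF rn[OF r']] permutes_bij[OF cn[OF c']] comp_assoc)
      also have "\<dots> = \<phi> (inv' r' \<circ> (r \<circ> c \<circ> inv' c'))"
        by (intro comm permutes_compose i rn[OF r] cn[OF c])
      finally have "\<phi> (r \<circ> c \<circ> inv' (r' \<circ> c')) = \<phi> (inv' r' \<circ> r \<circ> (c \<circ> inv' c'))"
        by (simp add: comp_assoc)
      moreover have "sign (c \<circ> inv' c') = sign c * sign c'"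
        using pc[OF c] pc[OF c'] by (simp add: sign_compose permutation_inverse sign_inverse)
      ultimately show ?thesis by (simp add: mult.assoc mult.commute mult.left_commute)
    qed
    then have "(\<Sum>r\<in>?R. \<Sum>c\<in>?C. ?T r c r' c') =
      (\<Sum>r\<in>?R. \<Sum>c\<in>?C. of_int (sign (c \<circ> inv' c')) * \<phi> (inv' r' \<circ> r \<circ> (c \<circ> inv' c')))"
      by (intro sum.cong refl)
    also have "\<dots> = (\<Sum>r\<in>?R. \<Sum>c\<in>?C. of_int (sign c) * \<phi> (inv' r' \<circ> r \<circ> c))"
      by (intro sum.cong refl sum_permutations_compose_right[OF ic, symmetric])
    also have "\<dots> = L"
      unfolding L_def by (rule setum_permutations_compose_left[OF ir, symmetric])
    finally show ?thesis .
  qed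
  have "(\<Sum>i\<in>?R \<times> ?C. \<Sum>j\<in>?R \<times> ?C. cnj (of_int (sign (snd i))) *
      \<phi> ((fst i \<circ> snd i) \<circ> inv' (fst j \<circ> snd j)) * of_int (sign (snd j))) \<in> \<real>\<^sub>\<ge>\<^sub>0"
    using \<phi> fin by (intro positive_definite_fun_finite_form[where g = "\<lambda>i. fst i \<circ> snd i" and x = "\<lambda>i. of_int (sign (snd i))"])
      (auto simp: block_character_def simp del: One_nat_def intro!: hook_permutes(2)[OF a])
  also have "(\<Sum>i\<in>?R \<times> ?C. \<Sum>j\<in>?R \<times> ?C. cnj (of_int (sign (snd i))) *
      \<phi> ((fst i \<circ> snd i) \<circ> inv' (fst j \<circ> snd j)) * of_int (sign (snd j))) =
      (\<Sum>j\<in>?R \<times> ?C. \<Sum>i\<in>?R \<times> ?C. ?T (fst i) (snd i) (fst j) (snd j))"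
    by (subst sum.swap) simp
  also have "\<dots> = (\<Sum>j\<in>?R \<times> ?C. L)"
  proof (intro sum.cong refl)
    fix j assume "j \<in> ?R \<times> ?C"
    then have "fst j \<in> ?R" "snd j \<in> ?C" by auto
    from inner[OF this]
    show "(\<Sum>i\<in>?R \<times> ?C. ?T (fst i) (snd i) (fst j) (snd j)) = L"
      by (simp only: sum.cartesian_product case_prod_unfold)
  qed
  also have "\<dots> = of_real (real (card (?R \<times> ?C))) * L" by simp
  finally have "of_real (real (card (?R \<times> ?C))) * L \<in> \<real>\<^sub>\<ge>\<^sub>0" .
  moreover have "?R \<times> ?C \<noteq> {}" using permutes_id by blast
  then have "card (?R \<times> ?C) > 0" using fin by (simp only: card_gt_0_iff finite_SigmaI) simp
  ultimately have "L \<in> \<real>\<^sub>\<ge>\<^sub>0"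
    by (auto simp: complex_nonneg_Reals_iff zero_le_mult_iff simp del: card_cartesian_product of_real_of_nat_eq)
  then show ?thesis using \<open>hook_functional n a \<phi> = L\<close> by simp
qed

text \<open>The arm \<open>Suc n - k\<close> puts the single nonzero entry of
  \<open>eulerian_hook\<close> at \<open>k\<close>.\<close>

lemma hook_functional_block_tau:
  assumes "j \<in> {1..n}" "k \<in> {1..n}"
  shows "hook_functional n (Suc n - k) (block_tau n j) = (if j = k then fact n else 0)"
proof -
  let ?a = "Suc n - k"
  have a: "1 \<le> ?a" "?a \<le> n" using assms by auto
  have "hook_functional n ?a (block_tau n j) =
    (\<Sum>c | c permutes {?a..n}. \<Sum>r | r permutes {1..?a}. of_int (sign c) * eulerian n (\<lambda>x. of_nat x ^ num_cycles n (c \<circ> r)) j)"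
    unfolding hook_functional_def
    by (intro sum.cong refl) (simp add: block_tau_eq_eulerian[OF hook_permutes(1)[OF a]] del: One_nat_def)
  also have "\<dots> = eulerian n (\<lambda>x. \<Sum>c | c permutes {?a..n}. \<Sum>r | r permutes {1..?a}.
      of_int (sign c) * of_nat x ^ num_cycles n (c \<circ> r)) j"
    by (simp add: mult.commute[of "of_int (sign _)"] eulerian_linear_sum
        eulerian_linear_sum[where c = "\<lambda>_. 1", simplified])
  also have "\<dots> = (if j = n - ?a + 1 then fact n else 0)"
    unfolding sum_hook_cycle_powers[OF a] by (rule eulerian_hook[OF a])
  also have "n - ?a + 1 = k" using assms by auto
  finally show ?thesis .
qed

section \<open>Simplices from dual functionals\<close>

text \<open>The functionals read off coordinates up to nonzero factors, which gives independence.
  For extremality, let \<open>t i\<close> lie strictly between \<open>x\<close> and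
  \<open>y\<close>: every other coordinate is nonnegative at both and averages to 0, so it vanishes
  at both.\<close>

lemma dual_system_simplex:
  fixes t :: "'i \<Rightarrow> 'v::real_vector" and L :: "'i \<Rightarrow> 'v \<Rightarrow> real"
  assumes fin: "finite I"
    and lin: "\<And>i. i \<in> I \<Longrightarrow> linear (L i)"
    and diag: "\<And>i. i \<in> I \<Longrightarrow> L i (t i) \<noteq> 0"
    and off_diag: "\<And>i j. i \<in> I \<Longrightarrow> j \<in> I \<Longrightarrow> i \<noteq> j \<Longrightarrow> L i (t j) = 0"
  shows "inj_on t I" "\<not> affine_dependent (t ` I)"
    "{x. x extreme_point_of (convex hull (t ` I))} = t ` I"
proof -
  show inj: "inj_on t I"
    by (intro inj_onI) (metis diag off_diag)
  have coord: "L i (\<Sum>j\<in>I. u j *\<^sub>R t j) = u i * L i (t i)" if i: "i \<in> I" for u i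
  proof -
    have "L i (\<Sum>j\<in>I. u j *\<^sub>R t j) = (\<Sum>j\<in>I. u j * L i (t j))"
      using lin[OF i] by (simp add: linear_sum linear_scale)
    also have "\<dots> = (\<Sum>j\<in>I. if j = i then u i * L i (t i) else 0)"
      using off_diag[OF i] by (intro sum.cong) auto
    finally show ?thesis using fin i by (simp add: sum.delta)
  qed
  have reindex: "(\<Sum>v\<in>t ` I. u v *\<^sub>R v) = (\<Sum>j\<in>I. u (t j) *\<^sub>R t j)"
    and reindex1: "(\<Sum>v\<in>t ` I. u v) = (\<Sum>j\<in>I. u (t j))" for u
    by (simp_all add: sum.reindex[OF inj])
  have "u (t i) = 0" if "(\<Sum>v\<in>t ` I. u v *\<^sub>R v) = 0" "i \<in> I" for u i
    using coord[OF that(2), of "u \<circ> t"] that diag[OF that(2)] linear_0[OF lin[OF that(2)]] reindex[of u] by simp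
  then have "\<not> dependent (t ` I)"
    using fin by (subst dependent_finite) auto
  then show "\<not> affine_dependent (t ` I)"
    using affine_dependent_imp_dependent by blast
  have repr: "\<exists>\<alpha>. (\<forall>i\<in>I. \<alpha> i \<ge> 0) \<and> sum \<alpha> I = 1 \<and> x = (\<Sum>j\<in>I. \<alpha> j *\<^sub>R t j)"
    if "x \<in> convex hull (t ` I)" for x
  proof -
    have "x \<in> {y. \<exists>u. (\<forall>v\<in>t ` I. 0 \<le> u v) \<and> sum u (t ` I) = 1 \<and> (\<Sum>v\<in>t ` I. u v *\<^sub>R v) = y}"
      using that fin by (simp only: convex_hull_finite finite_imageI)
    then obtain u where u: "\<forall>v\<in>t ` I. u v \<ge> 0" "sum u (t ` I) = 1" "(\<Sum>v\<in>t ` I. u v *\<^sub>R v) = x"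
      by (elim CollectE exE conjE)
    show ?thesis
    proof (intro exI conjI)
      show "\<forall>i\<in>I. u (t i) \<ge> 0" using u(1) by simp
      show "(\<Sum>i\<in>I. u (t i)) = 1" using u(2) unfolding reindex1 .
      show "x = (\<Sum>j\<in>I. u (t j) *\<^sub>R t j)" using u(3) unfolding reindex by (rule sym)
    qed
  qed
  have "t i extreme_point_of (convex hull (t ` I))" if i: "i \<in> I" for i
    unfolding extreme_point_of_def
  proof (intro conjI ballI notI)
    show "t i \<in> convex hull (t ` I)" using i by (simp add: hull_inc)
    fix x y
    assume "x \<in> convex hull (t ` I)" "y \<in> convex hull (t ` I)" and seg: "t i \<in> open_segment x y"
    then obtain \<alpha> \<beta> where
      \<alpha>: "\<forall>i\<in>I. \<alpha> i \<ge> 0" "sum \<alpha> I = 1" "x = (\<Sum>j\<in>I. \<alpha> j *\<^sub>R t j)" and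
      \<beta>: "\<forall>i\<in>I. \<beta> i \<ge> 0" "sum \<beta> I = 1" "y = (\<Sum>j\<in>I. \<beta> j *\<^sub>R t j)"
      using repr by metis
    obtain s where s: "x \<noteq> y" "0 < s" "s < 1" "t i = (1 - s) *\<^sub>R x + s *\<^sub>R y"
      using seg by (auto simp: in_segment)
    have zero: "\<alpha> j = 0 \<and> \<beta> j = 0" if j: "j \<in> I" "j \<noteq> i" for j
    proof -
      have "0 = L j ((1 - s) *\<^sub>R x + s *\<^sub>R y)" using off_diag[OF j(1) i j(2)] s(4) by simp
      also have "\<dots> = (1 - s) * (\<alpha> j * L j (t j)) + s * (\<beta> j * L j (t j))"
        using lin[OF j(1)] coord[OF j(1)] \<alpha>(3) \<beta>(3) by (simp add: linear_add linear_scale)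
      finally have "((1 - s) * \<alpha> j + s * \<beta> j) * L j (t j) = 0" by (simp add: algebra_simps)
      then have "(1 - s) * \<alpha> j + s * \<beta> j = 0" using diag[OF j(1)] by simp
      moreover have "(1 - s) * \<alpha> j \<ge> 0" "s * \<beta> j \<ge> 0" using \<alpha>(1) \<beta>(1) j(1) s by auto
      ultimately have "(1 - s) * \<alpha> j = 0" "s * \<beta> j = 0" by linarith+
      then show ?thesis using s by simp
    qed
    have single: "(\<Sum>j\<in>I. \<gamma> j *\<^sub>R t j) = t i" if "\<forall>j\<in>I. j \<noteq> i \<longrightarrow> \<gamma> j = 0" "sum \<gamma> I = 1" for \<gamma>
    proof -
      have "sum \<gamma> I = \<gamma> i" "(\<Sum>j\<in>I. \<gamma> j *\<^sub>R t j) = \<gamma> i *\<^sub>R t i"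
        using that(1) fin i by (simp_all add: sum.remove[of I i])
      then show ?thesis using that(2) by simp
    qed
    have "x = t i" "y = t i" using single \<alpha> \<beta> zero by auto
    then show False using s(1) by simp
  qed
  then show "{x. x extreme_point_of (convex hull (t ` I))} = t ` I"
    using extreme_point_of_convex_hull by blast
qed

lemma linear_Re_hook_functional: "linear (\<lambda>\<phi>. Re (hook_functional n a \<phi>))"
  by (rule linearI)
    (simp_all add: hook_functional_def scaleR_fun_def sum.distrib algebra_simps sum_distrib_left)

lemma positive_definite_fun_combination:
  assumes "positive_definite_fun (sym_group n) \<phi>" "positive_definite_fun (sym_group n) \<psi>"
    and "0 \<le> u" "0 \<le> v"
  shows "positive_definite_fun (sym_group n) (\<lambda>g. of_real u * \<phi> g + of_real v * \<psi> g)"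
  unfolding positive_definite_fun_sym_group_iff
proof (intro allI impI conjI)
  fix m and g :: "nat \<Rightarrow> nat \<Rightarrow> nat"
  assume g: "\<forall>i<m. g i permutes {1..n}"
  have h: "hermitian m (\<lambda>i j. \<phi> (g i \<circ> inv' (g j)))" "hermitian m (\<lambda>i j. \<psi> (g i \<circ> inv' (g j)))"
    and d: "nonneg_definite m (\<lambda>i j. \<phi> (g i \<circ> inv' (g j)))" "nonneg_definite m (\<lambda>i j. \<psi> (g i \<circ> inv' (g j)))"
    using assms(1,2) g unfolding positive_definite_fun_sym_group_iff by blast+
  have "of_real u * \<phi> (g i \<circ> inv' (g j)) + of_real v * \<psi> (g i \<circ> inv' (g j)) =
      cnj (of_real u * \<phi> (g j \<circ> inv' (g i)) + of_real v * \<psi> (g j \<circ> inv' (g i)))"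
    if "i < m" "j < m" for i j
  proof -
    have "\<phi> (g i \<circ> inv' (g j)) = cnj (\<phi> (g j \<circ> inv' (g i)))" "\<psi> (g i \<circ> inv' (g j)) = cnj (\<psi> (g j \<circ> inv' (g i)))"
      using h that unfolding hermitian_def by blast+
    then show ?thesis by simp
  qed
  then show "hermitian m (\<lambda>i j. of_real u * \<phi> (g i \<circ> inv' (g j)) + of_real v * \<psi> (g i \<circ> inv' (g j)))"
    unfolding hermitian_def by blast
  show "nonneg_definite m (\<lambda>i j. of_real u * \<phi> (g i \<circ> inv' (g j)) + of_real v * \<psi> (g i \<circ> inv' (g j)))"
    unfolding nonneg_definite_def
  proof
    fix x :: "nat \<Rightarrow> complex"
    let ?Q = "\<lambda>\<phi>. \<Sum>i<m. \<Sum>j<m. cnj (x i) * \<phi> (g i \<circ> inv' (g j)) * x j"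
    have "?Q (\<lambda>p. of_real u * \<phi> p + of_real v * \<psi> p) = of_real u * ?Q \<phi> + of_real v * ?Q \<psi>"
      by (simp add: sum.distrib sum_distrib_left algebra_simps)
    moreover have "?Q \<phi> \<in> \<real>\<^sub>\<ge>\<^sub>0" "?Q \<psi> \<in> \<real>\<^sub>\<ge>\<^sub>0" using d unfolding nonneg_definite_def by blast+
    ultimately show "?Q (\<lambda>p. of_real u * \<phi> p + of_real v * \<psi> p) \<in> \<real>\<^sub>\<ge>\<^sub>0"
      using assms(3,4) by (simp add: nonneg_Reals_add_I nonneg_Reals_mult_I)
  qed
qed

section \<open>The convex set of normalized block characters\<close>

lemma convex_normalized_block_characters: "convex (normalized_block_characters n)"
proof (rule convexI)
  fix \<phi> \<psi> and u v :: real
  assume \<phi>: "\<phi> \<in> normalized_block_characters n" and \<psi>: "\<psi> \<in> normalized_block_characters n"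
    and uv: "0 \<le> u" "0 \<le> v" "u + v = 1"
  have eq: "u *\<^sub>R \<phi> + v *\<^sub>R \<psi> = (\<lambda>g. of_real u * \<phi> g + of_real v * \<psi> g)"
    by (simp add: fun_eq_iff scaleR_fun_def scaleR_conv_of_real)
  obtain f1 f2 where f: "\<And>g. g \<in> carrier (sym_group n) \<Longrightarrow> \<phi> g = f1 (num_cycles n g)"
    "\<And>g. g \<in> carrier (sym_group n) \<Longrightarrow> \<psi> g = f2 (num_cycles n g)"
    using \<phi> \<psi> unfolding normalized_block_characters_def block_character_def block_function_def by blast
  have "block_function n (\<lambda>g. of_real u * \<phi> g + of_real v * \<psi> g)"
    unfolding block_function_def
    by (rule exI[of _ "\<lambda>l. of_real u * f1 l + of_real v * f2 l"]) (simp add: f)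
  moreover have "of_real u + of_real v = (1 :: complex)" using uv(3) by (metis of_real_1 of_real_add)
  ultimately show "u *\<^sub>R \<phi> + v *\<^sub>R \<psi> \<in> normalized_block_characters n"
    using \<phi> \<psi> uv positive_definite_fun_combination[of n \<phi> \<psi> u v] unfolding eq
    by (simp add: normalized_block_characters_def block_character_def)
qed

lemma block_tau_one:
  "block_tau n k \<one>\<^bsub>sym_group n\<^esub> = of_real (eulerian n (\<lambda>x. real x ^ n) k)"
  by (simp add: sym_group_one block_tau_eq_eulerian permutes_id of_real_eulerian)

lemma block_tau_eq_0:
  "g \<notin> carrier (sym_group n) \<Longrightarrow> block_tau n k g = 0"
  by (simp add: block_tau_def block_sigma_def)

definition normalized_block_tau :: "nat \<Rightarrow> nat \<Rightarrow> (nat \<Rightarrow> nat) \<Rightarrow> complex" where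
  "normalized_block_tau n k g = block_tau n k g / block_tau n k \<one>\<^bsub>sym_group n\<^esub>"

lemma normalized_block_tau_mem:
  assumes "k \<in> {1..n}"
  shows "normalized_block_tau n k \<in> normalized_block_characters n"
proof -
  define e where "e = eulerian n (\<lambda>x. real x ^ n) k"
  have e: "e > 0" unfolding e_def by (rule eulerian_power_pos[OF assms])
  \<comment> \<open>Scaling is written as a combination with second coefficient 0 to fit
    \<open>positive_definite_fun_combination\<close>.\<close>
  have t: "normalized_block_tau n k = (\<lambda>g. of_real (1 / e) * block_tau n k g + of_real 0 * block_tau n k g)"
    by (simp add: normalized_block_tau_def block_tau_one e_def fun_eq_iff)
  have "n \<ge> 1" using assms by simp
  then have "positive_definite_fun (sym_group n) (normalized_block_tau n k)"
    unfolding t by (intro positive_definite_fun_combination positive_definite_block_tau) (use e in auto)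
  moreover have "block_function n (normalized_block_tau n k)"
    unfolding block_function_def
    by (rule exI[of _ "\<lambda>l. eulerian n (\<lambda>x. of_nat x ^ l) k / of_real e"])
      (simp add: normalized_block_tau_def block_tau_one e_def block_tau_eq_eulerian sym_group_carrier)
  ultimately show ?thesis
    using e by (simp add: normalized_block_characters_def block_character_def normalized_block_tau_def
        block_tau_eq_0 block_tau_one e_def)
qed

lemma hook_functional_normalized_block_tau:
  assumes "j \<in> {1..n}" "k \<in> {1..n}"
  shows "hook_functional n (Suc n - k) (normalized_block_tau n j) =
    (if j = k then of_real (fact n / eulerian n (\<lambda>x. real x ^ n) k) else 0)"
proof -
  have "hook_functional n (Suc n - k) (normalized_block_tau n j) =
    hook_functional n (Suc n - k) (block_tau n j) / block_tau n j \<one>\<^bsub>sym_group n\<^esub>"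
    by (simp add: hook_functional_def normalized_block_tau_def sum_divide_distrib)
  then show ?thesis
    unfolding hook_functional_block_tau[OF assms] block_tau_one by simp
qed

lemma num_cycles_mem:
  assumes "n \<ge> 1"
  shows "num_cycles n g \<in> {1..n}"
proof -
  have "num_cycles n g \<le> card {1..n}" unfolding num_cycles_def by (rule card_image_le) simp
  moreover have "num_cycles n g \<noteq> 0" using assms by (simp add: num_cycles_def)
  ultimately show ?thesis by simp
qed

text \<open>The coefficients of an expansion exist by \<open>eulerian_span\<close>, are nonnegative
  by the hook functionals, and sum to 1 by evaluation at the identity.\<close>

lemma normalized_block_characters_subset_hull:
  assumes "n \<ge> 1"
  shows "normalized_block_characters n \<subseteq> convex hull (normalized_block_tau n ` {1..n})"
proof
  fix \<phi> assume \<phi>: "\<phi> \<in> normalized_block_characters n"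
  let ?t = "normalized_block_tau n"
  define e where "e k = eulerian n (\<lambda>x. real x ^ n) k" for k
  have e: "e k > 0" if "k \<in> {1..n}" for k unfolding e_def by (rule eulerian_power_pos[OF that])
  obtain f where f: "\<And>g. g permutes {1..n} \<Longrightarrow> \<phi> g = f (num_cycles n g)"
    using \<phi> by (auto simp: normalized_block_characters_def block_character_def block_function_def sym_group_carrier)
  obtain c where c: "\<forall>l\<in>{1..n}. f l = (\<Sum>k\<in>{1..n}. c k * eulerian n (\<lambda>x. of_nat x ^ l) k)"
    using eulerian_span[of n f] by blast
  \<comment> \<open>Accounts for the normalization: \<open>e k\<close> is the value of tau_k at the
    identity.\<close>
  define d where "d k = c k * of_real (e k)" for k
  have expand: "\<phi> g = (\<Sum>k\<in>{1..n}. d k * ?t k g)" for g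
  proof (cases "g \<in> carrier (sym_group n)")
    case True
    then have g: "g permutes {1..n}" by (simp add: sym_group_carrier)
    have "\<phi> g = (\<Sum>k\<in>{1..n}. c k * eulerian n (\<lambda>x. of_nat x ^ num_cycles n g) k)"
      using f[OF g] c num_cycles_mem[OF assms] by metis
    also have "\<dots> = (\<Sum>k\<in>{1..n}. d k * ?t k g)"
    proof (intro sum.cong refl)
      fix k assume "k \<in> {1..n}"
      then have "e k \<noteq> 0" using e by force
      then show "c k * eulerian n (\<lambda>x. of_nat x ^ num_cycles n g) k = d k * ?t k g"
        by (simp add: d_def normalized_block_tau_def block_tau_one block_tau_eq_eulerian[OF g] flip: e_def)
    qed
    finally show ?thesis .
  next
    case False
    then show ?thesis using \<phi>
      by (simp add: normalized_block_characters_def normalized_block_tau_def block_tau_eq_0)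
  qed
  have d: "d k \<in> \<real>\<^sub>\<ge>\<^sub>0" if k: "k \<in> {1..n}" for k
  proof -
    let ?a = "Suc n - k"
    \<comment> \<open>The functional is linear over the complex numbers and isolates
      \<open>d k\<close> up to the positive factor \<open>fact n / e k\<close>, so
      \<open>d k\<close> is both real and nonnegative.\<close>
    have "hook_functional n ?a \<phi> = (\<Sum>i\<in>{1..n}. d i * hook_functional n ?a (?t i))"
    proof -
      have "\<phi> = (\<lambda>g. \<Sum>i\<in>{1..n}. d i * ?t i g)" using expand by (simp add: fun_eq_iff)
      then have "hook_functional n ?a \<phi> = (\<Sum>c | c permutes {?a..n}. \<Sum>r | r permutes {1..?a}. \<Sum>i\<in>{1..n}.
          d i * (of_int (sign c) * ?t i (c \<circ> r)))"
        by (simp add: hook_functional_def sum_distrib_left mult.left_commute)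
      also have "\<dots> = (\<Sum>c | c permutes {?a..n}. \<Sum>i\<in>{1..n}. \<Sum>r | r permutes {1..?a}.
          d i * (of_int (sign c) * ?t i (c \<circ> r)))"
        by (intro sum.cong refl sum.swap)
      also have "\<dots> = (\<Sum>i\<in>{1..n}. d i * hook_functional n ?a (?t i))"
        unfolding hook_functional_def sum_distrib_left by (rule sum.swap)
      finally show ?thesis .
    qed
    also have "\<dots> = (\<Sum>i\<in>{1..n}. if i = k then d k * of_real (fact n / e k) else 0)"
      by (intro sum.cong refl) (simp add: hook_functional_normalized_block_tau[OF _ k] flip: e_def)
    also have "\<dots> = d k * of_real (fact n / e k)" using k by (simp add: sum.delta)
    finally have "d k * of_real (fact n / e k) \<in> \<real>\<^sub>\<ge>\<^sub>0"
      using hook_functional_nonneg[of ?a n \<phi>] \<phi> k by (auto simp: normalized_block_characters_def)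
    moreover have "of_real (e k / fact n) \<in> (\<real>\<^sub>\<ge>\<^sub>0 :: complex set)" using e[OF k] by (simp only: nonneg_Reals_of_real_iff) simp
    ultimately have "d k * of_real (fact n / e k) * of_real (e k / fact n) \<in> \<real>\<^sub>\<ge>\<^sub>0"
      by (rule nonneg_Reals_mult_I)
    moreover have "of_real (fact n / e k) * of_real (e k / fact n) = (1 :: complex)"
      using e[OF k] by (simp flip: of_real_mult)
    ultimately show ?thesis by (simp only: mult.assoc mult_1_right)
  qed
  then have dRe: "d k = of_real (Re (d k))" "Re (d k) \<ge> 0" if "k \<in> {1..n}" for k
    using d[OF that] by (auto simp: complex_nonneg_Reals_iff complex_eq_iff)
  have "1 = \<phi> \<one>\<^bsub>sym_group n\<^esub>" using \<phi> by (simp add: normalized_block_characters_def)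
  also have "\<dots> = (\<Sum>k\<in>{1..n}. d k)"
    unfolding expand
  proof (intro sum.cong refl)
    fix k assume "k \<in> {1..n}"
    then have "?t k \<one>\<^bsub>sym_group n\<^esub> = 1"
      using normalized_block_tau_mem[of k n] by (simp add: normalized_block_characters_def)
    then show "d k * ?t k \<one>\<^bsub>sym_group n\<^esub> = d k" by simp
  qed
  finally have sum1: "(\<Sum>k\<in>{1..n}. Re (d k)) = 1" by (metis Re_sum one_complex.sel(1))
  have sum_apply: "(\<Sum>k\<in>A. F k) g = (\<Sum>k\<in>A. F k g)" for A and F :: "nat \<Rightarrow> (nat \<Rightarrow> nat) \<Rightarrow> complex" and g
    by (induction A rule: infinite_finite_induct) auto
  have "\<phi> = (\<Sum>k\<in>{1..n}. Re (d k) *\<^sub>R ?t k)"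
  proof
    fix g
    have "\<phi> g = (\<Sum>k\<in>{1..n}. of_real (Re (d k)) * ?t k g)"
      unfolding expand by (intro sum.cong refl) (use dRe(1) in metis)
    then show "\<phi> g = (\<Sum>k\<in>{1..n}. Re (d k) *\<^sub>R ?t k) g"
      by (simp add: sum_apply scaleR_fun_def scaleR_conv_of_real)
  qed
  also have "\<dots> \<in> convex hull (?t ` {1..n})"
    by (rule convex_sum) (use sum1 dRe in \<open>auto intro: hull_inc simp: convex_convex_hull\<close>)
  finally show "\<phi> \<in> convex hull (?t ` {1..n})" .
qed

theorem corollary3p2:
  fixes n :: nat
  assumes "n \<ge> 1"
  shows "is_simplex (normalized_block_characters n) \<and>
    bij_betw (\<lambda>k g. block_tau n k g / block_tau n k \<one>\<^bsub>sym_group n\<^esub>) {1..n}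
      {\<phi>. \<phi> extreme_point_of normalized_block_characters n}"
proof -
  let ?t = "normalized_block_tau n"
  have hull: "normalized_block_characters n = convex hull (?t ` {1..n})"
    by (intro subset_antisym normalized_block_characters_subset_hull assms hull_minimal
        convex_normalized_block_characters) (auto intro: normalized_block_tau_mem)
  \<comment> \<open>Real parts are taken to obtain real linear functionals; the values at the
    normalized tau_j are real already.\<close>
  let ?L = "\<lambda>k \<phi>. Re (hook_functional n (Suc n - k) \<phi>)"
  have "?L k (?t k) \<noteq> 0" if "k \<in> {1..n}" for k
    using eulerian_power_pos[OF that, where 'a = real] that
    by (simp add: hook_functional_normalized_block_tau less_imp_neq[symmetric])
  moreover have "?L k (?t j) = 0" if "k \<in> {1..n}" "j \<in> {1..n}" "k \<noteq> j" for j k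
    using that by (simp add: hook_functional_normalized_block_tau)
  ultimately have dual: "inj_on ?t {1..n}" "\<not> affine_dependent (?t ` {1..n})"
      "{\<phi>. \<phi> extreme_point_of (convex hull (?t ` {1..n}))} = ?t ` {1..n}"
    using dual_system_simplex[of "{1..n}" ?L ?t] linear_Re_hook_functional by auto
  have "is_simplex (normalized_block_characters n)"
    unfolding is_simplex_def hull using dual(2) by blast
  moreover have "bij_betw ?t {1..n} {\<phi>. \<phi> extreme_point_of normalized_block_characters n}"
    unfolding hull dual(3) using dual(1) by (rule inj_on_imp_bij_betw)
  moreover have "?t = (\<lambda>k g. block_tau n k g / block_tau n k \<one>\<^bsub>sym_group n\<^esub>)"
    by (simp add: fun_eq_iff normalized_block_tau_def)
  ultimately show ?thesis by simp
qed

end
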